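(* Let $n,t$ be positive integers with $n\geq 3t+6$, and let $G$ be a $(P_6+tP_2)$-saturated graph on $n$ vertices. If $G$ has at least two isolated vertices and $|E(G)|\leq 3t+18$, then $|E(G)| = 3t+18$ and $G$ is isomorphic to $K_7 + (t-1)K_3 + \overline{K}_{n-3t-4}$.
   Context: All graphs are finite and simple. For graphs $G,H$, $G+H$ denotes the disjoint union and $tG$ the disjoint union of $t$ copies of $G$. $P_k$ is the path on $k$ vertices, $K_k$ the complete graph on $k$ vertices, $\overline{K}_m$ the edgeless graph on $m$ vertices. A graph $G$ is $H$-saturated if $G$ contains no subgraph isomorphic to $H$, but $G+e$ contains a subgraph isomorphic to $H$ for every edge $e$ of the complement of $G$. *)

theory Defs
  imports Main
begin

text \<open>Undirected graphs; an edge is the two-element set of its endpoints.\<close>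

record 'a graph =
  verts :: "'a set"
  edges :: "'a set set"

definition simple_graph :: "'a graph \<Rightarrow> bool" where
  "simple_graph G \<longleftrightarrow> finite (verts G) \<and> (\<forall>e\<in>edges G. e \<subseteq> verts G \<and> card e = 2)"

definition subgraph :: "'a graph \<Rightarrow> 'a graph \<Rightarrow> bool" where
  "subgraph S G \<longleftrightarrow> simple_graph S \<and> verts S \<subseteq> verts G \<and> edges S \<subseteq> edges G"

definition isomorphic :: "'a graph \<Rightarrow> 'b graph \<Rightarrow> bool" (infix "\<cong>\<^sub>g" 50) where
  "G \<cong>\<^sub>g H \<longleftrightarrow> (\<exists>f. bij_betw f (verts G) (verts H) \<and>
     (\<forall>u\<in>verts G. \<forall>v\<in>verts G. {u, v} \<in> edges G \<longleftrightarrow> {f u, f v} \<in> edges H))"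

definition contains_copy :: "'a graph \<Rightarrow> 'b graph \<Rightarrow> bool" where
  "contains_copy G H \<longleftrightarrow> (\<exists>S. subgraph S G \<and> S \<cong>\<^sub>g H)"

definition complement :: "'a graph \<Rightarrow> 'a graph" where
  "complement G = \<lparr>verts = verts G,
     edges = {e. e \<subseteq> verts G \<and> card e = 2 \<and> e \<notin> edges G}\<rparr>"

definition add_edge :: "'a graph \<Rightarrow> 'a set \<Rightarrow> 'a graph" where
  "add_edge G e = \<lparr>verts = verts G, edges = insert e (edges G)\<rparr>"

definition saturated :: "'b graph \<Rightarrow> 'a graph \<Rightarrow> bool" where
  "saturated H G \<longleftrightarrow> \<not> contains_copy G H \<and>
     (\<forall>e\<in>edges (complement G). contains_copy (add_edge G e) H)"

definition isolated_verts :: "'a graph \<Rightarrow> 'a set" where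
  "isolated_verts G = {v \<in> verts G. \<forall>e\<in>edges G. v \<notin> e}"

definition disjoint_union :: "'a graph \<Rightarrow> 'b graph \<Rightarrow> ('a + 'b) graph" (infixl "\<uplus>\<^sub>g" 65) where
  "G \<uplus>\<^sub>g H = \<lparr>verts = verts G <+> verts H,
     edges = (`) Inl ` edges G \<union> (`) Inr ` edges H\<rparr>"

definition copies :: "nat \<Rightarrow> 'a graph \<Rightarrow> (nat \<times> 'a) graph" where
  "copies t G = \<lparr>verts = {..<t} \<times> verts G,
     edges = (\<Union>i<t. (`) (Pair i) ` edges G)\<rparr>"

definition path_graph :: "nat \<Rightarrow> nat graph" where
  "path_graph k = \<lparr>verts = {..<k}, edges = {{i, Suc i} | i. Suc i < k}\<rparr>"

definition complete_graph :: "nat \<Rightarrow> nat graph" where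
  "complete_graph k = \<lparr>verts = {..<k}, edges = {e. e \<subseteq> {..<k} \<and> card e = 2}\<rparr>"

definition empty_graph :: "nat \<Rightarrow> nat graph" where
  "empty_graph m = \<lparr>verts = {..<m}, edges = {}\<rparr>"

lemma simple_graph_path: "simple_graph (path_graph k)"
  by (auto simp: simple_graph_def path_graph_def)

lemma simple_graph_complete: "simple_graph (complete_graph k)"
  by (auto simp: simple_graph_def complete_graph_def)

lemma simple_graph_empty: "simple_graph (empty_graph m)"
  by (auto simp: simple_graph_def empty_graph_def)

lemma simple_graph_disjoint_union:
  "simple_graph G \<Longrightarrow> simple_graph H \<Longrightarrow> simple_graph (G \<uplus>\<^sub>g H)"
  by (fastforce simp: simple_graph_def disjoint_union_def card_image)

lemma simple_graph_copies: "simple_graph G \<Longrightarrow> simple_graph (copies t G)"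
  by (fastforce simp: simple_graph_def copies_def card_image inj_on_def)

end

theory Submission
  imports Defs
begin

text \<open>
  Everything rests on the matching number of \<open>G\<close>. Joining the two isolated vertices shows that
  \<open>G\<close> contains \<open>P\<^sub>6 + (t - 1)P\<^sub>2\<close>, hence a matching of size \<open>t + 2\<close>. A matching \<open>M\<close> of size
  \<open>t + 3\<close> is impossible: no \<open>P\<^sub>6\<close> may meet only three edges of \<open>M\<close>, which forces \<open>M\<close> to cover
  the third vertex \<open>c\<close> of any \<open>P\<^sub>6\<close>. Joining \<open>c\<close> to an isolated vertex gives a matching \<open>N\<close> of
  size \<open>t + 2\<close> that misses \<open>c\<close>, and an \<open>N\<close>-augmenting path from \<open>c\<close> has length at most three;
  the few resulting configurations all contain a forbidden \<open>P\<^sub>6\<close>.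

  So the matching number is \<open>t + 2\<close>, and any two nonadjacent vertices are missed simultaneously by
  some maximum matching. As in Gallai's lemma, adjacency is then transitive, and \<open>G\<close> is a disjoint
  union of odd cliques \<open>K\<^bsub>2m+1\<^esub>\<close> whose parameters \<open>m\<close> sum to \<open>t + 2\<close>. The bound follows from
  \<open>m(2m + 1) = 3m + 2m(m - 1)\<close>, since the clique containing a \<open>P\<^sub>6\<close> has \<open>m \<ge> 3\<close>.
\<close>

section \<open>Matchings and six-vertex paths\<close>

definition adj :: "'a set set \<Rightarrow> 'a \<Rightarrow> 'a \<Rightarrow> bool" where
  "adj E x y \<longleftrightarrow> {x, y} \<in> E"

lemma adj_sym: "adj E x y \<Longrightarrow> adj E y x"
  by (simp add: adj_def insert_commute)

definition matching :: "'a set set \<Rightarrow> 'a set set \<Rightarrow> bool" where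
  "matching E M \<longleftrightarrow> M \<subseteq> E \<and> pairwise disjnt M"

definition path6 :: "'a set set \<Rightarrow> 'a \<Rightarrow> 'a \<Rightarrow> 'a \<Rightarrow> 'a \<Rightarrow> 'a \<Rightarrow> 'a \<Rightarrow> bool" where
  "path6 E a b c d e f \<longleftrightarrow> distinct [a, b, c, d, e, f] \<and>
     adj E a b \<and> adj E b c \<and> adj E c d \<and> adj E d e \<and> adj E e f"

text \<open>Containment of P6 + tP2 stated on the bare edge set: the six named vertices form the
  path and \<open>F\<close> is the tP2. For simple graphs it agrees with
  \<open>contains_copy\<close>, as the section on copies shows.\<close>

definition has_P6_tP2 :: "nat \<Rightarrow> 'a set set \<Rightarrow> bool" where
  "has_P6_tP2 t E \<longleftrightarrow> (\<exists>a b c d e f F. path6 E a b c d e f \<and>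
     matching E F \<and> card F = t \<and> \<Union>F \<inter> {a, b, c, d, e, f} = {})"

lemma matching_adjD: "matching E M \<Longrightarrow> adj M x y \<Longrightarrow> adj E x y"
  by (auto simp: matching_def adj_def)

lemma matching_unique:
  assumes M: "matching E M" and xy: "adj M x y" and xz: "adj M x z"
  shows "y = z"
proof -
  have "{x, y} = {x, z}"
  proof (rule ccontr)
    assume "{x, y} \<noteq> {x, z}"
    then have "disjnt {x, y} {x, z}"
      using M xy xz unfolding matching_def adj_def by (auto dest: pairwiseD)
    then show False by simp
  qed
  then show ?thesis by (auto simp: doubleton_eq_iff)
qed

lemma matching_Diff: "matching E M \<Longrightarrow> matching E (M - X)"
  by (auto simp: matching_def pairwise_def)

lemma matching_insert:
  "matching E M \<Longrightarrow> adj E x y \<Longrightarrow> x \<notin> \<Union>M \<Longrightarrow> y \<notin> \<Union>M \<Longrightarrow> matching E (insert {x, y} M)"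
  by (auto simp: matching_def pairwise_def adj_def disjnt_def)

lemma adj_commute: "adj E x y \<longleftrightarrow> adj E y x"
  by (auto dest: adj_sym)

text \<open>This rule and the next let the simplifier settle the many path configurations: once the
  partner of a vertex is known, any further \<open>M\<close>-adjacency at either end becomes an
  equation between vertices.\<close>

lemma matching_adj_iff: "matching E M \<Longrightarrow> adj M x y \<Longrightarrow> adj M x z \<longleftrightarrow> z = y"
  by (auto dest: matching_unique)

lemma matching_adj_iff': "matching E M \<Longrightarrow> adj M x y \<Longrightarrow> adj M y z \<longleftrightarrow> z = x"
  by (auto dest: matching_unique adj_sym)

lemma matching_notin_Union_Diff:
  assumes "matching E M" "e \<in> M" "v \<in> e"
  shows "v \<notin> \<Union>(M - {e})"
  using assms unfolding matching_def pairwise_def disjnt_def by blast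

lemma adj_insert: "adj (insert e M) x y \<longleftrightarrow> e = {x, y} \<or> adj M x y"
  by (auto simp: adj_def)

text \<open>Kept free of a vertex set and of any forbidden subgraph, so that it applies both to the
  given edges and to the edges enlarged by a new one.\<close>

locale edge_set =
  fixes E :: "'a set set"
  assumes finite_E: "finite E"
    and card_edge: "e \<in> E \<Longrightarrow> card e = 2"
begin

lemma adj_irrefl: "adj E x y \<Longrightarrow> x \<noteq> y"
  using card_edge by (force simp: adj_def)

lemma edge_other: "e \<in> E \<Longrightarrow> x \<in> e \<Longrightarrow> \<exists>y. e = {x, y}"
  using card_edge[of e] by (auto simp: card_2_iff)

lemma matching_finite: "matching E M \<Longrightarrow> finite M"
  using finite_E by (auto simp: matching_def dest: finite_subset)

lemma covered_iff: "matching E M \<Longrightarrow> x \<in> \<Union>M \<longleftrightarrow> (\<exists>y. adj M x y)"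
proof (rule iffI)
  assume M: "matching E M" and "x \<in> \<Union>M"
  then obtain e where e: "e \<in> M" "x \<in> e" by blast
  then have "e \<in> E" using M by (auto simp: matching_def)
  then obtain y where "e = {x, y}" using edge_other e(2) by blast
  then show "\<exists>y. adj M x y" using e(1) by (auto simp: adj_def)
next
  assume "\<exists>y. adj M x y"
  then show "x \<in> \<Union>M" by (auto simp: adj_def)
qed

lemma card_insert_edge:
  "matching E M \<Longrightarrow> x \<notin> \<Union>M \<Longrightarrow> card (insert {x, y} M) = Suc (card M)"
  using matching_finite[of M] by (subst card_insert_disjoint) auto

lemma matching_card_insert:
  assumes "matching E M" "adj E x y" "x \<notin> \<Union>M" "y \<notin> \<Union>M"
  shows "matching E (insert {x, y} M) \<and> card (insert {x, y} M) = Suc (card M)"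
  using matching_insert[OF assms] card_insert_edge[OF assms(1,3)] by simp

lemma matching_card_remove:
  assumes "matching E M" "adj M x y"
  shows "matching E (M - {{x, y}})" "Suc (card (M - {{x, y}})) = card M"
    "x \<notin> \<Union>(M - {{x, y}})" "y \<notin> \<Union>(M - {{x, y}})"
proof -
  show "matching E (M - {{x, y}})" using assms(1) by (rule matching_Diff)
  have "{x, y} \<in> M" using assms(2) by (simp add: adj_def)
  then show "Suc (card (M - {{x, y}})) = card M"
    using matching_finite[OF assms(1)] card_Suc_Diff1[of M "{x, y}"] by blast
  show "x \<notin> \<Union>(M - {{x, y}})" "y \<notin> \<Union>(M - {{x, y}})"
    using matching_notin_Union_Diff[OF assms(1) \<open>{x, y} \<in> M\<close>] by auto
qed

text \<open>The first, third and fifth edges of a P6 are disjoint, so a copy of P6 + kP2 carries a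
  matching of size \<open>k + 3\<close>.\<close>

lemma path6_matching:
  assumes P: "path6 E a b c d e f" and F: "matching E F" "\<Union>F \<inter> {a, b, c, d, e, f} = {}"
  defines "N \<equiv> insert {a, b} (insert {c, d} (insert {e, f} F))"
  shows "matching E N" "card N = card F + 3"
proof -
  have p: "distinct [a, b, c, d, e, f]" "adj E a b" "adj E c d" "adj E e f"
    using P by (auto simp: path6_def)
  have 1: "matching E (insert {e, f} F) \<and> card (insert {e, f} F) = Suc (card F)"
    by (rule matching_card_insert) (use F p in auto)
  have 2: "matching E (insert {c, d} (insert {e, f} F)) \<and>
      card (insert {c, d} (insert {e, f} F)) = Suc (card (insert {e, f} F))"
    by (rule matching_card_insert) (use F p 1 in auto)
  have 3: "matching E N \<and> card N = Suc (card (insert {c, d} (insert {e, f} F)))"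
    unfolding N_def by (rule matching_card_insert) (use F p 2 in auto)
  show "matching E N" "card N = card F + 3" using 1 2 3 by auto
qed

end

section \<open>Large matchings\<close>

locale P6_tP2_free = edge_set E for E :: "'a set set" +
  fixes t :: nat
  assumes free: "\<not> has_P6_tP2 t E"
begin

text \<open>
  The vertices \<open>x\<close>, \<open>y\<close>, \<open>z\<close> represent the at most three edges of \<open>M\<close> that the path meets; the other
  edges of \<open>M\<close> supply \<open>tP\<^sub>2\<close>.
\<close>

lemma no_path6_on_three:
  assumes M: "matching E M" and cM: "card M \<ge> t + 3"
    and P: "path6 E a b c d e f"
    and T: "\<And>v w. v \<in> {a, b, c, d, e, f} \<Longrightarrow> adj M v w \<Longrightarrow> v \<in> {x, y, z} \<or> w \<in> {x, y, z}"
  shows False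
proof -
  have fM: "finite M" using M by (rule matching_finite)
  define ed where "ed v = {e \<in> M. v \<in> e}" for v
  have ed1: "card (ed v) \<le> 1" for v
  proof -
    have "e1 = e2" if "e1 \<in> ed v" "e2 \<in> ed v" for e1 e2
      using that M unfolding ed_def matching_def pairwise_def disjnt_def by blast
    then show ?thesis using fM card_le_Suc0_iff_eq[of "ed v"] by (auto simp: ed_def)
  qed
  let ?T = "ed x \<union> ed y \<union> ed z"
  have fT: "finite ?T" using fM by (simp add: ed_def)
  have "card ?T \<le> card (ed x) + card (ed y) + card (ed z)"
    using card_Un_le[of "ed x \<union> ed y" "ed z"] card_Un_le[of "ed x" "ed y"] by linarith
  then have "card ?T \<le> 3" using ed1[of x] ed1[of y] ed1[of z] by linarith
  then have "t \<le> card (M - ?T)"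
    using cM diff_card_le_card_Diff[OF fT, of M] by linarith
  then obtain F where F: "F \<subseteq> M - ?T" "card F = t"
    by (meson obtain_subset_with_card_n)
  have mF: "matching E F"
    using M F unfolding matching_def by (auto intro: pairwise_subset)
  have "\<Union>F \<inter> {a, b, c, d, e, f} = {}"
  proof (rule ccontr)
    assume "\<Union>F \<inter> {a, b, c, d, e, f} \<noteq> {}"
    then obtain g v where gv: "g \<in> F" "v \<in> g" "v \<in> {a, b, c, d, e, f}" by blast
    then have gM: "g \<in> M" "g \<notin> ?T" using F by auto
    then have "g \<in> E" using M by (auto simp: matching_def)
    then obtain w where w: "g = {v, w}" using edge_other gv(2) by blast
    then have "v \<in> {x, y, z} \<or> w \<in> {x, y, z}" using T[OF gv(3), of w] gM by (simp add: adj_def)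
    then show False using gM w by (auto simp: ed_def)
  qed
  then have "has_P6_tP2 t E" unfolding has_P6_tP2_def using P mF F(2) by blast
  then show False using free by simp
qed

text \<open>If \<open>M\<close> misses \<open>c\<close>, only five vertices of a P6 through
  \<open>c\<close> can meet edges of \<open>M\<close>, and it suffices to bring these down to three
  edges. Rerouting along the \<open>M\<close>-edge at \<open>p5\<close> shows first that both
  neighbours \<open>p2\<close> and \<open>p4\<close> of \<open>c\<close> are covered; then a path
  beginning with \<open>p2' p2 c p4 p5\<close> is built.\<close>

lemma third_vertex_covered:
  assumes M: "matching E M" and cM: "card M \<ge> t + 3"
    and P: "path6 E p1 p2 c p4 p5 p6"
  shows "\<exists>z. adj M c z"
proof (rule ccontr)
  assume "\<nexists>z. adj M c z"
  then have uc: "\<not> adj M c z" "\<not> adj M z c" for z using adj_sym[of M] by blast+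
  note no = no_path6_on_three[OF M cM]
  note mi = matching_adj_iff[OF M] matching_adj_iff'[OF M]
  note mE = matching_adjD[OF M]
  have ne: "x \<noteq> y" if "adj M x y" for x y using mE[OF that] adj_irrefl by blast
  note Es = adj_commute[of E]
  have d: "distinct [p1,p2,c,p4,p5,p6]"
    and a: "adj E p1 p2" "adj E p2 c" "adj E c p4" "adj E p4 p5" "adj E p5 p6"
    using P by (auto simp: path6_def)
  have "\<exists>w. adj M p2 w"
  proof (rule ccontr)
    assume "\<nexists>w. adj M p2 w"
    then have u2: "\<not> adj M p2 z" "\<not> adj M z p2" for z using adj_sym[of M] by blast+
    \<comment> \<open>\<open>c\<close> and \<open>p2\<close> are uncovered. If \<open>p5\<close> had
      no partner outside \<open>p1\<close>, \<open>p4\<close>, \<open>p6\<close>, the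
      \<open>M\<close>-edges at these three vertices would be all that the path meets.\<close>
    have "\<exists>w. adj M p5 w \<and> w \<notin> {p1,p4,p6}"
      using no[OF P, of p1 p4 p6] uc u2 by blast
    then obtain w where w: "adj M p5 w" "w \<notin> {p1,p4,p6}" by blast
    have "w \<noteq> c" "w \<noteq> p2" using w uc u2 by auto
    then have Q: "path6 E w p5 p4 c p2 p1"
      using w d a mE[OF w(1)] ne[OF w(1)] by (auto simp: path6_def Es)
    show False by (rule no[OF Q, of p5 p4 p1]) (use uc u2 mi[OF w(1)] in auto)
  qed
  then obtain p2' where p2': "adj M p2 p2'" by blast
  have "\<exists>w. adj M p4 w"
  proof (rule ccontr)
    assume "\<nexists>w. adj M p4 w"
    then have u2: "\<not> adj M p4 z" "\<not> adj M z p4" for z using adj_sym[of M] by blast+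
    have "\<exists>w. adj M p5 w \<and> w \<notin> {p1,p2,p6}"
      using no[OF P, of p1 p2 p6] uc u2 by blast
    then obtain w where w: "adj M p5 w" "w \<notin> {p1,p2,p6}" by blast
    have "p2' \<noteq> p5" "p2' \<noteq> w" using w p2' d mi[OF p2'] mi[OF w(1)] by auto
    moreover have "w \<noteq> c" "w \<noteq> p4" "p2' \<noteq> c" "p2' \<noteq> p4" using w p2' uc u2 by auto
    ultimately have Q: "path6 E w p5 p4 c p2 p2'"
      using w d a mE[OF w(1)] ne[OF w(1)] ne[OF p2'] mE[OF p2'] by (auto simp: path6_def Es)
    show False by (rule no[OF Q, of p5 p2 p2]) (use uc u2 mi[OF w(1)] mi[OF p2'] in auto)
  qed
  then obtain p4' where p4': "adj M p4 p4'" by blast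
  have u: "p4' \<noteq> c" "p2' \<noteq> c" using p4' p2' uc by auto
  note mm = mi[OF p2'] mi[OF p4'] and mEE = mE[OF p2'] mE[OF p4'] ne[OF p2'] ne[OF p4']
  \<comment> \<open>The aim is that \<open>p2'\<close> differs from \<open>p4\<close>,
    \<open>p5\<close> and \<open>p6\<close>, so that it can replace \<open>p1\<close> as the first
    vertex of the path.\<close>
  have n24: "p2' \<noteq> p4"
  proof
    assume eq: "p2' = p4"
    have "\<exists>w. adj M p5 w \<and> w \<notin> {p1,p2,p6}"
      using no[OF P, of p1 p2 p6] uc p2' mm eq by blast
    then obtain w where w: "adj M p5 w" "w \<notin> {p1,p2,p6}" by blast
    have "w \<noteq> c" using w uc by auto
    moreover have "w \<noteq> p4"
      using mi(2)[OF w(1), of p2] adj_sym[OF p2'] eq d by auto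
    ultimately have Q: "path6 E w p5 p4 c p2 p1"
      using w d a mE[OF w(1)] ne[OF w(1)] by (auto simp: path6_def Es)
    show False by (rule no[OF Q, of p5 p4 p1]) (use uc p2' eq mm mi[OF w(1)] in auto)
  qed
  have n42: "p4' \<noteq> p2" using n24 mm(1)[of p4] adj_sym[OF p4'] by auto
  have nn: "p2' \<noteq> p4'" using mm(2)[of p4] d adj_sym[OF p4'] by auto
  have n25: "p2' \<noteq> p5"
  proof
    assume eq: "p2' = p5"
    have "p4' \<noteq> p6"
    proof
      assume "p4' = p6"
      then show False using no[OF P, of p1 p2 p4] uc eq mm by blast
    qed
    moreover have "p4' \<noteq> p5" using nn eq by simp
    ultimately have Q: "path6 E p4' p4 c p2 p5 p6"
      using d a mEE u n42 eq by (auto simp: path6_def Es)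
    show False by (rule no[OF Q, of p4 p2 p6]) (use uc eq mm in auto)
  qed
  have n26: "p2' \<noteq> p6"
  proof
    assume eq: "p2' = p6"
    have "p4' \<noteq> p5"
    proof
      assume "p4' = p5"
      then show False using no[OF P, of p1 p2 p4] uc eq mm by blast
    qed
    moreover have "p4' \<noteq> p6" using nn eq by simp
    ultimately have Q: "path6 E p4' p4 c p2 p6 p5"
      using d a mEE u n42 eq by (auto simp: path6_def Es)
    show False by (rule no[OF Q, of p4 p2 p5]) (use uc eq mm in auto)
  qed
  \<comment> \<open>The vertices \<open>p2' p2 c p4 p5\<close> use the \<open>M\<close>-edges at
    \<open>p2\<close> and \<open>p4\<close>. The sixth vertex is the partner of \<open>p5\<close>,
    or \<open>p6\<close> when \<open>p5\<close> is unmatched or matched to \<open>p4\<close>; either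
    way only one more edge is met.\<close>
  show False
  proof (cases "\<exists>w. adj M p5 w \<and> w \<noteq> p4")
    case True
    then obtain w where w: "adj M p5 w" "w \<noteq> p4" by blast
    have "w \<noteq> c" using w uc by auto
    moreover have "w \<noteq> p2" using mi(2)[OF w(1), of p2'] p2' n25 by auto
    moreover have "w \<noteq> p2'" using mi(2)[OF w(1), of p2] adj_sym[OF p2'] d by auto
    ultimately have Q: "path6 E p2' p2 c p4 p5 w"
      using w d a mE[OF w(1)] ne[OF w(1)] mEE u n24 n25 by (auto simp: path6_def Es)
    show False by (rule no[OF Q, of p2 p4 p5]) (use uc mm mi[OF w(1)] in auto)
  next
    case False
    have Q: "path6 E p2' p2 c p4 p5 p6"
      using d a mEE u n24 n25 n26 by (auto simp: path6_def Es)
    show False by (rule no[OF Q, of p2 p4 p6]) (use uc mm False in auto)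
  qed
qed

text \<open>
  In the next three lemmas \<open>c - a - b - w\<close> is the augmenting path, where \<open>ab\<close> was the middle edge of a
  \<open>P\<^sub>6\<close>, or the first matching edge of a \<open>P\<^sub>5\<close> starting in \<open>c\<close>. An additional neighbour \<open>s\<close> always
  creates a \<open>P\<^sub>6\<close> on three matching edges.
\<close>

lemma central_edge_endgame:
  assumes M: "matching E M" and cM: "card M \<ge> t + 3"
    and d: "distinct [c, a, b, w, q1, q2, q5, q6]"
    and m: "adj M c a" "adj M b w" "adj M q1 q2" "adj M q5 q6"
    and a: "adj E q2 a" "adj E a b" "adj E b q5"
    and s: "adj E c s" "s \<noteq> a"
  shows False
proof -
  note no = no_path6_on_three[OF M cM]
  note mi = m[THEN matching_adj_iff[OF M]] m[THEN matching_adj_iff'[OF M]]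
  note mE = m[THEN matching_adjD[OF M]]
  note Es = adj_commute[of E]
  have "s \<noteq> c" using adj_irrefl[OF s(1)] by simp
  note facts = d a mE s this
  have "s \<noteq> q1"
  proof
    assume eq: "s = q1"
    have Q: "path6 E q2 q1 c a b w" using facts eq by (auto simp: path6_def Es)
    show False by (rule no[OF Q, of q1 c b]) (use mi in auto)
  qed
  note facts = facts this
  have "s \<noteq> q2"
  proof
    assume eq: "s = q2"
    have Q: "path6 E q1 q2 c a b w" using facts eq by (auto simp: path6_def Es)
    show False by (rule no[OF Q, of q1 c b]) (use mi in auto)
  qed
  note facts = facts this
  have "s \<noteq> q5"
  proof
    assume eq: "s = q5"
    have Q: "path6 E q6 q5 c a b w" using facts eq by (auto simp: path6_def Es)
    show False by (rule no[OF Q, of q5 c b]) (use mi in auto)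
  qed
  note facts = facts this
  have "s \<noteq> q6"
  proof
    assume eq: "s = q6"
    have Q: "path6 E q5 q6 c a b w" using facts eq by (auto simp: path6_def Es)
    show False by (rule no[OF Q, of q5 c b]) (use mi in auto)
  qed
  note facts = facts this
  have "s \<noteq> b"
  proof
    assume eq: "s = b"
    have Q: "path6 E w b c a q2 q1" using facts eq by (auto simp: path6_def Es)
    show False by (rule no[OF Q, of b c q1]) (use mi in auto)
  qed
  note facts = facts this
  have "s \<noteq> w"
  proof
    assume eq: "s = w"
    have Q: "path6 E q1 q2 a c w b" using facts eq by (auto simp: path6_def Es)
    show False by (rule no[OF Q, of q1 c b]) (use mi in auto)
  qed
  note facts = facts this
  \<comment> \<open>Now \<open>s\<close> avoids all named vertices. A partner \<open>r\<close> of
    \<open>s\<close> is put in front of it, so that \<open>rs\<close> counts as one edge; an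
    unmatched \<open>s\<close> starts the path itself and meets no edge of \<open>M\<close>.\<close>
  show False
  proof (cases "\<exists>r. adj M s r")
    case True
    then obtain r where r: "adj M s r" by blast
    have "r \<noteq> c" using matching_adj_iff'[OF M r, of a] mi facts adj_sym[of M] m by auto
    note facts = facts this
    have "r \<noteq> a" using matching_adj_iff'[OF M r, of c] mi facts adj_sym[of M] m by auto
    note facts = facts this
    have "r \<noteq> q2" using matching_adj_iff'[OF M r, of q1] mi facts adj_sym[of M] m by auto
    note facts = facts this
    have "r \<noteq> q1" using matching_adj_iff'[OF M r, of q2] mi facts adj_sym[of M] m by auto
    note facts = facts this
    have Q: "path6 E r s c a q2 q1"
      using facts adj_irrefl[OF matching_adjD[OF M r]] matching_adjD[OF M r] by (auto simp: path6_def Es)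
    show False
      by (rule no[OF Q, of s c q1]) (use mi matching_adj_iff[OF M r] matching_adj_iff'[OF M r] in auto)
  next
    case False
    have Q: "path6 E s c a b q5 q6" using facts by (auto simp: path6_def Es)
    show False by (rule no[OF Q, of c b q5]) (use mi False in auto)
  qed
qed

lemma end_edge_endgame:
  assumes M: "matching E M" and cM: "card M \<ge> t + 3"
    and d: "distinct [c, a, b, w, q5, q6]"
    and m: "adj M c a" "adj M b w" "adj M q5 q6"
    and a: "adj E a b" "adj E b q5"
    and s: "adj E c s" "s \<noteq> a" "s \<noteq> b"
  shows False
proof -
  note no = no_path6_on_three[OF M cM]
  note mi = m[THEN matching_adj_iff[OF M]] m[THEN matching_adj_iff'[OF M]]
  note mE = m[THEN matching_adjD[OF M]]
  note Es = adj_commute[of E]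
  have "s \<noteq> c" using adj_irrefl[OF s(1)] by simp
  note facts = d a mE s this
  have "s \<noteq> w"
  proof
    assume eq: "s = w"
    have Q: "path6 E q6 q5 b a c w" using facts eq by (auto simp: path6_def Es)
    show False by (rule no[OF Q, of q5 c b]) (use mi in auto)
  qed
  note facts = facts this
  have "s \<noteq> q5"
  proof
    assume eq: "s = q5"
    have Q: "path6 E q6 q5 c a b w" using facts eq by (auto simp: path6_def Es)
    show False by (rule no[OF Q, of q5 c b]) (use mi in auto)
  qed
  note facts = facts this
  have "s \<noteq> q6"
  proof
    assume eq: "s = q6"
    have Q: "path6 E q5 q6 c a b w" using facts eq by (auto simp: path6_def Es)
    show False by (rule no[OF Q, of q5 c b]) (use mi in auto)
  qed
  note facts = facts this
  show False
  proof (cases "\<exists>r. adj M s r")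
    case True
    then obtain r where r: "adj M s r" by blast
    have "r \<noteq> c" using matching_adj_iff'[OF M r, of a] mi facts adj_sym[of M] m by auto
    note facts = facts this
    have "r \<noteq> a" using matching_adj_iff'[OF M r, of c] mi facts adj_sym[of M] m by auto
    note facts = facts this
    have "r \<noteq> b" using matching_adj_iff'[OF M r, of w] mi facts adj_sym[of M] m by auto
    note facts = facts this
    have "r \<noteq> w" using matching_adj_iff'[OF M r, of b] mi facts adj_sym[of M] m by auto
    note facts = facts this
    have Q: "path6 E r s c a b w"
      using facts adj_irrefl[OF matching_adjD[OF M r]] matching_adjD[OF M r] by (auto simp: path6_def Es)
    show False
      by (rule no[OF Q, of s c b]) (use mi matching_adj_iff[OF M r] matching_adj_iff'[OF M r] in auto)
  next
    case False
    have Q: "path6 E s c a b q5 q6" using facts by (auto simp: path6_def Es)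
    show False by (rule no[OF Q, of c b q5]) (use mi False in auto)
  qed
qed

lemma end_triangle_endgame:
  assumes M: "matching E M" and cM: "card M \<ge> t + 3"
    and d: "distinct [c, a, b, w, q5, q6]"
    and m: "adj M c a" "adj M b w" "adj M q5 q6"
    and a: "adj E a b" "adj E b q5" "adj E c b"
    and s: "adj E a s" "s \<noteq> c" "s \<noteq> b"
  shows False
proof -
  note no = no_path6_on_three[OF M cM]
  note mi = m[THEN matching_adj_iff[OF M]] m[THEN matching_adj_iff'[OF M]]
  note mE = m[THEN matching_adjD[OF M]]
  note Es = adj_commute[of E]
  have "s \<noteq> a" using adj_irrefl[OF s(1)] by simp
  note facts = d a mE s this
  have "s \<noteq> w"
  proof
    assume eq: "s = w"
    have Q: "path6 E w a c b q5 q6" using facts eq by (auto simp: path6_def Es)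
    show False by (rule no[OF Q, of b c q5]) (use mi in auto)
  qed
  note facts = facts this
  have "s \<noteq> q5"
  proof
    assume eq: "s = q5"
    have Q: "path6 E q6 q5 a c b w" using facts eq by (auto simp: path6_def Es)
    show False by (rule no[OF Q, of q5 c b]) (use mi in auto)
  qed
  note facts = facts this
  have "s \<noteq> q6"
  proof
    assume eq: "s = q6"
    have Q: "path6 E q5 q6 a c b w" using facts eq by (auto simp: path6_def Es)
    show False by (rule no[OF Q, of q5 c b]) (use mi in auto)
  qed
  note facts = facts this
  show False
  proof (cases "\<exists>r. adj M s r")
    case True
    then obtain r where r: "adj M s r" by blast
    have "r \<noteq> c" using matching_adj_iff'[OF M r, of a] mi facts adj_sym[of M] m by auto
    note facts = facts this
    have "r \<noteq> a" using matching_adj_iff'[OF M r, of c] mi facts adj_sym[of M] m by auto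
    note facts = facts this
    have "r \<noteq> b" using matching_adj_iff'[OF M r, of w] mi facts adj_sym[of M] m by auto
    note facts = facts this
    have "r \<noteq> w" using matching_adj_iff'[OF M r, of b] mi facts adj_sym[of M] m by auto
    note facts = facts this
    have Q: "path6 E r s a c b w"
      using facts adj_irrefl[OF matching_adjD[OF M r]] matching_adjD[OF M r] by (auto simp: path6_def Es)
    show False
      by (rule no[OF Q, of s c b]) (use mi matching_adj_iff[OF M r] matching_adj_iff'[OF M r] in auto)
  next
    case False
    have Q: "path6 E s a c b q5 q6" using facts by (auto simp: path6_def Es)
    show False by (rule no[OF Q, of c b q5]) (use mi False in auto)
  qed
qed

text \<open>
  Follow the path alternating between \<open>M\<close> and \<open>N\<close> from \<open>c\<close>: it cannot end in a vertex missed by \<open>M\<close>,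
  since switching \<open>M\<close> along it would uncover \<open>c\<close>, and after five edges it would be a forbidden \<open>P\<^sub>6\<close>.
\<close>

lemma augmenting_step:
  assumes M: "matching E M" and cM: "card M \<ge> t + 3"
    and N: "matching E N" "card N = t + 2" "c \<notin> \<Union>N"
    and covered: "\<forall>M'. matching E M' \<longrightarrow> card M' \<ge> t + 3 \<longrightarrow> c \<in> \<Union>M'"
  obtains (direct) a where "a \<notin> \<Union>N" "matching E (insert {c, a} N)" "card (insert {c, a} N) = t + 3"
      "adj E c a"
  | (through) a b w where "adj N a b" "w \<notin> \<Union>N" "w \<noteq> c" "adj E c a" "adj E b w"
      "matching E (insert {c, a} (insert {b, w} (N - {{a, b}})))"
      "card (insert {c, a} (insert {b, w} (N - {{a, b}}))) = t + 3"
proof -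
  note cov = covered[rule_format]
  note no = no_path6_on_three[OF M cM]
  note mE = matching_adjD[OF M] and nE = matching_adjD[OF N(1)]
  note ms = adj_sym[of M] and mu = matching_unique[OF M] and nu = matching_unique[OF N(1)]
  \<comment> \<open>The alternating path is followed as \<open>c - z - z' - w - w' - r\<close>, with
    \<open>cz\<close>, \<open>z'w\<close>, \<open>w'r\<close> in \<open>M\<close> and
    \<open>zz'\<close>, \<open>ww'\<close> in \<open>N\<close>. If it stops at \<open>z\<close> or
    \<open>w\<close>, it augments \<open>N\<close>.\<close>
  obtain z where z: "adj M c z"
    using cov[OF M cM] covered_iff[OF M] by blast
  have cz: "c \<noteq> z" using adj_irrefl[OF mE[OF z]] .
  show thesis
  proof (cases "z \<in> \<Union>N")
    case False
    then show thesis
      using matching_card_insert[OF N(1) mE[OF z] N(3)] N(2) mE[OF z] by (intro direct[of z]) auto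
  next
    case True
    then obtain z' where z': "adj N z z'" using covered_iff[OF N(1)] by blast
    have nc: "x \<noteq> c" if "adj N x y" for x y using that N(3) by (auto simp: adj_def)
    have zz': "z \<noteq> z'" "z' \<noteq> c" using adj_irrefl[OF nE[OF z']] nc[OF adj_sym[OF z']] by auto
    note rem = matching_card_remove[OF M z]
    have "z' \<in> \<Union>M"
    proof (rule ccontr)
      assume n: "z' \<notin> \<Union>M"
      let ?M = "insert {z, z'} (M - {{c, z}})"
      have "matching E ?M \<and> card ?M = Suc (card (M - {{c, z}}))"
        by (rule matching_card_insert) (use rem nE[OF z'] n in auto)
      then have "c \<in> \<Union>?M" using rem cM by (intro cov) auto
      then show False using rem(3) cz zz' by auto
    qed
    then obtain w where w: "adj M z' w" using covered_iff[OF M] by blast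
    have wz: "w \<noteq> c" "w \<noteq> z" "w \<noteq> z'"
      using mu[OF z ms[of z' c]] mu[OF ms[OF z] ms[of z' z]] w zz' adj_irrefl[OF mE[OF w]] by auto
    show thesis
    proof (cases "w \<in> \<Union>N")
      case False
      note remN = matching_card_remove[OF N(1) z']
      let ?N1 = "insert {z', w} (N - {{z, z'}})"
      have 1: "matching E ?N1 \<and> card ?N1 = Suc (card (N - {{z, z'}}))"
        by (rule matching_card_insert) (use remN mE[OF w] False in auto)
      let ?N2 = "insert {c, z} ?N1"
      have 2: "matching E ?N2 \<and> card ?N2 = Suc (card ?N1)"
        by (rule matching_card_insert) (use 1 remN mE[OF z] N(3) zz' wz in auto)
      show thesis
        by (rule through[OF z' False wz(1) mE[OF z] mE[OF w]]) (use 1 2 remN N in auto)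
    next
      case True
      then obtain w' where w': "adj N w w'" using covered_iff[OF N(1)] by blast
      have ww': "w' \<noteq> w" "w' \<noteq> c" "w' \<noteq> z" "w' \<noteq> z'"
        using adj_irrefl[OF nE[OF w']] nc[OF adj_sym[OF w']] nu[OF z' adj_sym[of N w z]]
          nu[OF adj_sym[OF z'] adj_sym[of N w z']] w' wz by auto
      let ?M1 = "M - {{c, z}} - {{z', w}}"
      have w1: "adj (M - {{c, z}}) z' w" using w wz zz' by (auto simp: adj_def doubleton_eq_iff)
      note rem1 = matching_card_remove[OF rem(1) w1]
      have "w' \<in> \<Union>M"
      proof (rule ccontr)
        assume n: "w' \<notin> \<Union>M"
        let ?M2 = "insert {w, w'} ?M1"
        have 1: "matching E ?M2 \<and> card ?M2 = Suc (card ?M1)"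
          by (rule matching_card_insert) (use rem1 nE[OF w'] n in auto)
        let ?M3 = "insert {z, z'} ?M2"
        have 2: "matching E ?M3 \<and> card ?M3 = Suc (card ?M2)"
          by (rule matching_card_insert) (use 1 rem1 rem nE[OF z'] ww' wz in auto)
        have "c \<in> \<Union>?M3" by (rule cov) (use 1 2 rem rem1 cM in auto)
        then show False using rem(3) cz zz' wz ww' by auto
      qed
      then obtain r where r: "adj M w' r" using covered_iff[OF M] by blast
      have "r \<noteq> c" "r \<noteq> z" "r \<noteq> z'" "r \<noteq> w" "r \<noteq> w'"
        using mu[OF z ms[of w' c]] mu[OF ms[OF z] ms[of w' z]] mu[OF w ms[of w' z']]
          mu[OF ms[OF w] ms[of w' w]] r ww' adj_irrefl[OF mE[OF r]] by auto
      then have Q: "path6 E c z z' w w' r"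
        using cz zz' wz ww' mE[OF z] nE[OF z'] mE[OF w] nE[OF w'] mE[OF r] by (auto simp: path6_def)
      have False
        by (rule no[OF Q, of c z' w'])
          (use matching_adj_iff[OF M z] matching_adj_iff'[OF M z] matching_adj_iff[OF M w]
             matching_adj_iff'[OF M w] matching_adj_iff[OF M r] matching_adj_iff'[OF M r] in auto)
      then show thesis ..
    qed
  qed
qed

text \<open>
  As \<open>u\<close> has degree one after the edge \<open>uv\<close> is added, that edge is a \<open>P\<^sub>2\<close> or an end edge of the \<open>P\<^sub>6\<close>.
\<close>

lemma pendant_edge_cases:
  assumes u: "u \<notin> \<Union>E" "u \<noteq> v" and t: "t > 0" and H: "has_P6_tP2 t (insert {u, v} E)"
  obtains (matching_edge) a b c d e f F where "path6 E a b c d e f" "matching E F" "card F + 1 = t"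
      "\<Union>F \<inter> {a, b, c, d, e, f} = {}" "v \<notin> {a, b, c, d, e, f}" "v \<notin> \<Union>F"
  | (end_edge) c d e f F where "distinct [v, c, d, e, f]" "adj E v c" "adj E c d" "adj E d e" "adj E e f"
      "matching E F" "card F = t" "\<Union>F \<inter> {v, c, d, e, f} = {}"
proof -
  from H obtain a b c d e f F where P: "path6 (insert {u, v} E) a b c d e f"
    and F: "matching (insert {u, v} E) F" "card F = t" "\<Union>F \<inter> {a, b, c, d, e, f} = {}"
    unfolding has_P6_tP2_def by blast
  have uE: "\<not> adj E u x" "\<not> adj E x u" for x using u by (auto simp: adj_def)
  have p: "distinct [a, b, c, d, e, f]" using P by (simp add: path6_def)
  have q: "adj (insert {u, v} E) a b" "adj (insert {u, v} E) b c" "adj (insert {u, v} E) c d"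
    "adj (insert {u, v} E) d e" "adj (insert {u, v} E) e f" using P by (simp_all add: path6_def)
  have out: "adj E x y" if "adj (insert {u, v} E) x y" "x \<noteq> u" "y \<noteq> u" for x y
    using that by (auto simp: adj_def doubleton_eq_iff)
  have inc: "x = u \<and> y = v \<or> x = v \<and> y = u" if "adj (insert {u, v} E) x y" "x = u \<or> y = u" for x y
    using that u uE[of x] uE[of y] by (auto simp: adj_def doubleton_eq_iff)
  show thesis
  proof (cases "{u, v} \<in> F")
    case True
    then have nu: "u \<notin> {a, b, c, d, e, f}" "v \<notin> {a, b, c, d, e, f}" using F(3) by auto
    have P': "path6 E a b c d e f" using p q nu by (auto simp: path6_def intro!: out)
    have "finite F" using t F(2) by (auto intro: card_ge_0_finite)
    then have "card (F - {{u, v}}) + 1 = t" using True F(2) card_Suc_Diff1[of F "{u, v}"] by linarith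
    moreover have "matching E (F - {{u, v}})"
      using matching_Diff[OF F(1), of "{{u, v}}"] by (auto simp: matching_def)
    moreover have "v \<notin> \<Union>(F - {{u, v}})" using matching_notin_Union_Diff[OF F(1) True] by auto
    ultimately show thesis using P' nu F(3) by (intro matching_edge) auto
  next
    case False
    then have F': "matching E F" using F(1) by (auto simp: matching_def)
    have "u \<in> {a, b, c, d, e, f}"
    proof (rule ccontr)
      assume "u \<notin> {a, b, c, d, e, f}"
      then have "path6 E a b c d e f" using p q by (auto simp: path6_def intro!: out)
      then show False using free F' F unfolding has_P6_tP2_def by blast
    qed
    moreover have "u \<noteq> b" using inc[OF q(1)] inc[OF q(2)] p by auto
    moreover have "u \<noteq> c" using inc[OF q(2)] inc[OF q(3)] p by auto
    moreover have "u \<noteq> d" using inc[OF q(3)] inc[OF q(4)] p by auto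
    moreover have "u \<noteq> e" using inc[OF q(4)] inc[OF q(5)] p by auto
    ultimately consider "u = a" | "u = f" by auto
    then show thesis
    proof cases
      case 1
      then have "b = v" using inc[OF q(1)] p by auto
      then show thesis using 1 p out[OF q(2)] out[OF q(3)] out[OF q(4)] out[OF q(5)] F F'
        by (intro end_edge[of c d e f F]) auto
    next
      case 2
      then have "e = v" using inc[OF q(5)] p by auto
      then show thesis using 2 p out[OF adj_sym[OF q(1)]] out[OF adj_sym[OF q(2)]]
          out[OF adj_sym[OF q(3)]] out[OF adj_sym[OF q(4)]] F F'
        by (intro end_edge[of d c b a F]) auto
    qed
  qed
qed

section \<open>Excluding matchings of size \<open>t + 3\<close>\<close>

lemma adjacent_path6_third_vertex:
  assumes "path6 E p1 p2 c p4 p5 p6"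
  shows "adj E c p2" "adj E c p4" "p2 \<noteq> p4"
  using assms by (auto simp: path6_def intro: adj_sym)

text \<open>The case where the added edge at \<open>c\<close> was one of the P2's. The alternate
  edges of \<open>Q\<close> complete \<open>F\<close> to a matching \<open>N\<close> of size
  \<open>t + 2\<close> missing \<open>c\<close>. Since every matching of size \<open>t + 3\<close>
  covers \<open>c\<close>, \<open>augmenting_step\<close> enlarges \<open>N\<close> by a path from
  \<open>c\<close> so short that \<open>Q\<close>, or a path obtained by changing one end of
  \<open>Q\<close>, still meets only three edges. The exception is an augmentation through the
  central edge of \<open>Q\<close>.\<close>

lemma no_large_matching_matching_edge:
  assumes P: "path6 E p1 p2 c p4 p5 p6"
    and Q: "path6 E q1 q2 q3 q4 q5 q6"
    and F: "matching E F" "card F + 1 = t" "\<Union>F \<inter> {q1, q2, q3, q4, q5, q6} = {}"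
    and c: "c \<notin> {q1, q2, q3, q4, q5, q6}" "c \<notin> \<Union>F"
    and M: "matching E M" "card M \<ge> t + 3"
  shows False
proof -
  define N where "N = insert {q1, q2} (insert {q3, q4} (insert {q5, q6} F))"
  have N: "matching E N" "card N = t + 2" "c \<notin> \<Union>N"
    using path6_matching[OF Q F(1,3)] F(2) c by (auto simp: N_def)
  have q: "distinct [q1, q2, q3, q4, q5, q6]" "adj E q1 q2" "adj E q2 q3" "adj E q3 q4"
    "adj E q4 q5" "adj E q5 q6" using Q by (auto simp: path6_def)
  have qN: "adj N q1 q2" "adj N q3 q4" "adj N q5 q6" by (auto simp: N_def adj_insert)
  note qN' = qN[THEN adj_sym]
  have cov: "\<forall>M'. matching E M' \<longrightarrow> card M' \<ge> t + 3 \<longrightarrow> c \<in> \<Union>M'"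
    using third_vertex_covered[OF _ _ P] covered_iff by metis
  note Es = adj_commute[of E]
  from M N cov show False
  proof (cases rule: augmenting_step)
    case (direct a)
    let ?M = "insert {c, a} N"
    have m: "adj ?M q1 q2" "adj ?M q3 q4" "adj ?M q5 q6" using qN by (auto simp: adj_insert)
    note mi = m[THEN matching_adj_iff[OF direct(2)]] m[THEN matching_adj_iff'[OF direct(2)]]
    show False
      by (rule no_path6_on_three[OF direct(2) _ Q, of q1 q3 q5]) (use direct(3) mi in auto)
  next
    case (through a b w)
    let ?M = "insert {c, a} (insert {b, w} (N - {{a, b}}))"
    note no = no_path6_on_three[OF through(6)]
    note mu = matching_unique[OF N(1)]
    have aw: "adj ?M c a" "adj ?M b w" by (auto simp: adj_insert)
    have keep: "adj ?M x y" if "adj N x y" "x \<noteq> a" "x \<noteq> b" for x y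
      using that by (auto simp: adj_def doubleton_eq_iff)
    have wq: "w \<notin> {q1, q2, q3, q4, q5, q6}" using through(2) by (auto simp: N_def)
    have ab: "adj N b a" using adj_sym[OF through(1)] .
    have ca: "c \<noteq> a" "b \<noteq> w" using adj_irrefl through(4,5) by blast+
    note facts = q c wq through(3,4,5) ca
    \<comment> \<open>The path \<open>P\<close> gives \<open>c\<close> two neighbours, hence one
      other than \<open>a\<close>; it is the extra neighbour that
      \<open>central_edge_endgame\<close> needs.\<close>
    obtain s where s: "adj E c s" "s \<noteq> a"
      using adjacent_path6_third_vertex[OF P] by blast
    have qb: "a = q1 \<Longrightarrow> b = q2" "a = q2 \<Longrightarrow> b = q1" "a = q3 \<Longrightarrow> b = q4"
      "a = q4 \<Longrightarrow> b = q3" "a = q5 \<Longrightarrow> b = q6" "a = q6 \<Longrightarrow> b = q5"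
      using mu through(1) qN qN' by blast+
    \<comment> \<open>The cases say which edge \<open>ab\<close> of \<open>N\<close> is given up. If
      it is an end edge of \<open>Q\<close>, the end vertex of \<open>Q\<close> is replaced by
      \<open>c\<close> or \<open>w\<close>; if it is the central edge, the endgame applies;
      otherwise \<open>Q\<close> itself is forbidden.\<close>
    consider "a = q1" | "a = q2" | "a = q3" | "a = q4"
      | "a = q5" | "a = q6" | "a \<notin> {q1, q2, q3, q4, q5, q6}" by blast
    then show False
    proof cases
      case 1
      note eq = 1 qb(1)[OF 1]
      have m: "adj ?M q2 w" "adj ?M q3 q4" "adj ?M q5 q6"
        using aw[THEN adj_sym] aw keep[OF qN(1)] keep[OF qN(2)] keep[OF qN(3)] eq facts by auto
      note mi = m[THEN matching_adj_iff[OF through(6)]] m[THEN matching_adj_iff'[OF through(6)]]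
      have R: "path6 E w q2 q3 q4 q5 q6" using facts eq by (auto simp: path6_def Es)
      show False by (rule no[OF _ R, of q2 q3 q5]) (use through(7) mi in auto)
    next
      case 2
      note eq = 2 qb(2)[OF 2]
      have m: "adj ?M q2 c" "adj ?M q3 q4" "adj ?M q5 q6"
        using aw[THEN adj_sym] aw keep[OF qN(1)] keep[OF qN(2)] keep[OF qN(3)] eq facts by auto
      note mi = m[THEN matching_adj_iff[OF through(6)]] m[THEN matching_adj_iff'[OF through(6)]]
      have R: "path6 E c q2 q3 q4 q5 q6" using facts eq by (auto simp: path6_def Es)
      show False by (rule no[OF _ R, of q2 q3 q5]) (use through(7) mi in auto)
    next
      case 3
      note eq = 3 qb(3)[OF 3]
      show False
        by (rule central_edge_endgame[OF through(6) _ _ aw, of q1 q2 q5 q6 s])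
          (use through(7) s facts eq keep[OF qN(1)] keep[OF qN(3)] in \<open>auto simp: Es\<close>)
    next
      case 4
      note eq = 4 qb(4)[OF 4]
      show False
        by (rule central_edge_endgame[OF through(6) _ _ aw, of q6 q5 q2 q1 s])
          (use through(7) s facts eq keep[OF qN'(3)] keep[OF qN'(1)] in \<open>auto simp: Es\<close>)
    next
      case 5
      note eq = 5 qb(5)[OF 5]
      have m: "adj ?M q1 q2" "adj ?M q3 q4" "adj ?M q5 c"
        using aw[THEN adj_sym] aw keep[OF qN(1)] keep[OF qN(2)] keep[OF qN(3)] eq facts by auto
      note mi = m[THEN matching_adj_iff[OF through(6)]] m[THEN matching_adj_iff'[OF through(6)]]
      have R: "path6 E q1 q2 q3 q4 q5 c" using facts eq by (auto simp: path6_def Es)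
      show False by (rule no[OF _ R, of q1 q3 q5]) (use through(7) mi in auto)
    next
      case 6
      note eq = 6 qb(6)[OF 6]
      have m: "adj ?M q1 q2" "adj ?M q3 q4" "adj ?M q5 w"
        using aw[THEN adj_sym] aw keep[OF qN(1)] keep[OF qN(2)] keep[OF qN(3)] eq facts by auto
      note mi = m[THEN matching_adj_iff[OF through(6)]] m[THEN matching_adj_iff'[OF through(6)]]
      have R: "path6 E q1 q2 q3 q4 q5 w" using facts eq by (auto simp: path6_def Es)
      show False by (rule no[OF _ R, of q1 q3 q5]) (use through(7) mi in auto)
    next
      case 7
      have "b \<notin> {q1, q2, q3, q4, q5, q6}" using 7 mu[OF ab] qN qN' by blast
      then have m: "adj ?M q1 q2" "adj ?M q3 q4" "adj ?M q5 q6"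
        using 7 keep[OF qN(1)] keep[OF qN(2)] keep[OF qN(3)] by auto
      note mi = m[THEN matching_adj_iff[OF through(6)]] m[THEN matching_adj_iff'[OF through(6)]]
      show False by (rule no[OF _ Q, of q1 q3 q5]) (use through(7) mi in auto)
    qed
  qed
qed

text \<open>The case where the added edge at \<open>c\<close> ended the P6, so that a P5 starting in
  \<open>c\<close> remains beside \<open>tP2\<close>. Two disjoint edges of this P5 complete
  \<open>F\<close> to a matching \<open>N\<close> of size \<open>t + 2\<close> missing
  \<open>c\<close>, which is augmented as before.\<close>

lemma no_large_matching_end_edge:
  assumes P: "path6 E p1 p2 c p4 p5 p6"
    and d: "distinct [c, q3, q4, q5, q6]"
    and q: "adj E c q3" "adj E q3 q4" "adj E q4 q5" "adj E q5 q6"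
    and F: "matching E F" "card F = t" "\<Union>F \<inter> {c, q3, q4, q5, q6} = {}"
    and M: "matching E M" "card M \<ge> t + 3"
  shows False
proof -
  define N where "N = insert {q3, q4} (insert {q5, q6} F)"
  have 1: "matching E (insert {q5, q6} F) \<and> card (insert {q5, q6} F) = Suc (card F)"
    by (rule matching_card_insert) (use F q in auto)
  have 2: "matching E N \<and> card N = Suc (card (insert {q5, q6} F))"
    unfolding N_def by (rule matching_card_insert) (use F d q 1 in auto)
  have N: "matching E N" "card N = t + 2" "c \<notin> \<Union>N"
    using 1 2 F d by (auto simp: N_def)
  have qN: "adj N q3 q4" "adj N q5 q6" by (auto simp: N_def adj_insert)
  note qN' = qN[THEN adj_sym]
  have cov: "\<forall>M'. matching E M' \<longrightarrow> card M' \<ge> t + 3 \<longrightarrow> c \<in> \<Union>M'"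
    using third_vertex_covered[OF _ _ P] covered_iff by metis
  note Es = adj_commute[of E]
  from M N cov show False
  proof (cases rule: augmenting_step)
    case (direct a)
    let ?M = "insert {c, a} N"
    have m: "adj ?M c a" "adj ?M q3 q4" "adj ?M q5 q6" using qN by (auto simp: adj_insert)
    note mi = m[THEN matching_adj_iff[OF direct(2)]] m[THEN matching_adj_iff'[OF direct(2)]]
    have "a \<notin> {q3, q4, q5, q6}" using direct(1) by (auto simp: N_def)
    then have R: "path6 E a c q3 q4 q5 q6"
      using d q direct(4) adj_irrefl[OF direct(4)] by (auto simp: path6_def Es)
    show False
      by (rule no_path6_on_three[OF direct(2) _ R, of c q3 q5]) (use direct(3) mi in auto)
  next
    case (through a b w)
    let ?M = "insert {c, a} (insert {b, w} (N - {{a, b}}))"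
    note no = no_path6_on_three[OF through(6)]
    note mu = matching_unique[OF N(1)]
    have aw: "adj ?M c a" "adj ?M b w" by (auto simp: adj_insert)
    have keep: "adj ?M x y" if "adj N x y" "x \<noteq> a" "x \<noteq> b" for x y
      using that by (auto simp: adj_def doubleton_eq_iff)
    have wq: "w \<notin> {q3, q4, q5, q6}" using through(2) by (auto simp: N_def)
    have ab: "adj N b a" using adj_sym[OF through(1)] .
    have ca: "c \<noteq> a" "b \<noteq> w" using adj_irrefl through(4,5) by blast+
    note facts = d q wq through(3,4,5) ca
    have qb: "a = q3 \<Longrightarrow> b = q4"
      "a = q4 \<Longrightarrow> b = q3" "a = q5 \<Longrightarrow> b = q6" "a = q6 \<Longrightarrow> b = q5"
      using mu through(1) qN qN' by blast+
    \<comment> \<open>Except when \<open>a = q3\<close>, the new matching edges \<open>ca\<close>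
      and \<open>bw\<close> allow the P5 to be extended or rerouted to a P6 on three matching
      edges.\<close>
    consider "a = q3" | "a = q4" | "a = q5" | "a = q6" | "a \<notin> {q3, q4, q5, q6}" by blast
    then show False
    proof cases
      case 1
      note eq = 1 qb(1)[OF 1]
      have m: "adj ?M q5 q6" using keep[OF qN(2)] eq facts by auto
      \<comment> \<open>Either \<open>c\<close> has a neighbour besides \<open>a\<close> and
        \<open>b\<close>, or its two neighbours on \<open>P\<close> are exactly these. Then
        \<open>c\<close>, \<open>a\<close>, \<open>b\<close> form a triangle, and the other
        neighbour of \<open>a\<close> on \<open>P\<close> serves as \<open>s\<close>.\<close>
      show False
      proof (cases "\<exists>s. adj E c s \<and> s \<noteq> a \<and> s \<noteq> b")
        case True
        then obtain s where s: "adj E c s" "s \<noteq> a" "s \<noteq> b" by blast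
        show False
          by (rule end_edge_endgame[OF through(6) _ _ aw m _ _ s]) (use through(7) facts eq in auto)
      next
        case False
        then have "p2 = a \<and> p4 = b \<or> p2 = b \<and> p4 = a"
          using adjacent_path6_third_vertex[OF P] by blast
        then obtain s where s: "adj E a s" "s \<noteq> c" "s \<noteq> b" "adj E c b"
          using P by (auto simp: path6_def intro: adj_sym)
        show False
          by (rule end_triangle_endgame[OF through(6) _ _ aw m _ _ s(4) s(1-3)])
            (use through(7) facts eq in auto)
      qed
    next
      case 2
      note eq = 2 qb(2)[OF 2]
      have m: "adj ?M q3 w" "adj ?M c q4" "adj ?M q5 q6"
        using aw[THEN adj_sym] aw keep[OF qN(1)] keep[OF qN(2)] eq facts by auto
      note mi = m[THEN matching_adj_iff[OF through(6)]] m[THEN matching_adj_iff'[OF through(6)]]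
      have R: "path6 E w q3 c q4 q5 q6" using facts eq by (auto simp: path6_def Es)
      show False by (rule no[OF _ R, of q3 c q5]) (use through(7) mi in auto)
    next
      case 3
      note eq = 3 qb(3)[OF 3]
      have m: "adj ?M q3 q4" "adj ?M c q5" "adj ?M q6 w"
        using aw[THEN adj_sym] aw keep[OF qN(1)] keep[OF qN(2)] eq facts by auto
      note mi = m[THEN matching_adj_iff[OF through(6)]] m[THEN matching_adj_iff'[OF through(6)]]
      have R: "path6 E q4 q3 c q5 q6 w" using facts eq by (auto simp: path6_def Es)
      show False by (rule no[OF _ R, of q3 c q6]) (use through(7) mi in auto)
    next
      case 4
      note eq = 4 qb(4)[OF 4]
      have m: "adj ?M q3 q4" "adj ?M c q6" "adj ?M q5 w"
        using aw[THEN adj_sym] aw keep[OF qN(1)] keep[OF qN(2)] eq facts by auto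
      note mi = m[THEN matching_adj_iff[OF through(6)]] m[THEN matching_adj_iff'[OF through(6)]]
      have R: "path6 E q4 q3 c q6 q5 w" using facts eq by (auto simp: path6_def Es)
      show False by (rule no[OF _ R, of q3 c q5]) (use through(7) mi in auto)
    next
      case 5
      have "b \<notin> {q3, q4, q5, q6}" using 5 mu[OF ab] qN qN' by blast
      then have m: "adj ?M c a" "adj ?M q3 q4" "adj ?M q5 q6"
        using 5 aw keep[OF qN(1)] keep[OF qN(2)] by auto
      note mi = m[THEN matching_adj_iff[OF through(6)]] m[THEN matching_adj_iff'[OF through(6)]]
      have R: "path6 E a c q3 q4 q5 q6" using facts 5 by (auto simp: path6_def Es)
      show False by (rule no[OF _ R, of c q3 q5]) (use through(7) mi in auto)
    qed
  qed
qed

text \<open>The isolated \<open>u\<close> makes \<open>uc\<close> a pendant edge, and its two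
  possible roles in the copy that it creates are excluded separately.\<close>

lemma no_large_matching:
  assumes P: "path6 E p1 p2 c p4 p5 p6" and t: "t > 0"
    and u: "u \<notin> \<Union>E" and H: "has_P6_tP2 t (insert {u, c} E)"
    and M: "matching E M"
  shows "card M \<le> t + 2"
proof (rule ccontr)
  assume "\<not> card M \<le> t + 2"
  then have cM: "card M \<ge> t + 3" by simp
  have "c \<in> \<Union>E" using P by (auto simp: path6_def adj_def)
  then have "u \<noteq> c" using u by blast
  from u this t H show False
  proof (cases rule: pendant_edge_cases)
    case (matching_edge a b c' d e f F)
    show False by (rule no_large_matching_matching_edge[OF P matching_edge M cM])
  next
    case (end_edge c' d e f F)
    show False by (rule no_large_matching_end_edge[OF P end_edge M cM])
  qed
qed

end

section \<open>Clique structure\<close>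

locale P6_tP2_saturated = P6_tP2_free E t for E :: "'a set set" and t :: nat +
  fixes V :: "'a set"
  assumes finite_V: "finite V" and edge_sub: "e \<in> E \<Longrightarrow> e \<subseteq> V"
    and t_pos: "t > 0"
    and saturating: "x \<in> V \<Longrightarrow> y \<in> V \<Longrightarrow> x \<noteq> y \<Longrightarrow> \<not> adj E x y \<Longrightarrow> has_P6_tP2 t (insert {x, y} E)"
    and isolated: "\<exists>u v. u \<in> V \<and> v \<in> V \<and> u \<noteq> v \<and> u \<notin> \<Union>E \<and> v \<notin> \<Union>E"
begin

section \<open>The matching number is \<open>t + 2\<close>\<close>

lemma finite_edge: "e \<in> E \<Longrightarrow> finite e"
  using edge_sub finite_V finite_subset by blast

lemma not_adj_isolated: "u \<notin> \<Union>E \<Longrightarrow> \<not> adj E u x"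
  by (auto simp: adj_def)

lemma maximum_matching_and_path6:
  obtains a b c d e f N where "path6 E a b c d e f" "matching E N" "card N = t + 2"
proof -
  obtain u v where uv: "u \<in> V" "v \<in> V" "u \<noteq> v" "u \<notin> \<Union>E" "v \<notin> \<Union>E"
    using isolated by blast
  have H: "has_P6_tP2 t (insert {u, v} E)"
    using saturating uv not_adj_isolated by blast
  from uv(4,3) t_pos H show thesis
  proof (cases rule: pendant_edge_cases)
    case (matching_edge a b c d e f F)
    show thesis
      using path6_matching[OF matching_edge(1,2,4)] matching_edge(3)
      by (intro that[OF matching_edge(1)]) auto
  next
    \<comment> \<open>This would give the isolated vertex \<open>v\<close> a neighbour in
      \<open>E\<close>, so the new edge can only have been one of the P2's.\<close>
    case (end_edge c d e f F)
    then show thesis using not_adj_isolated uv(5) by blast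
  qed
qed

lemma matching_card_le:
  assumes M: "matching E M"
  shows "card M \<le> t + 2"
proof -
  obtain a b c d e f N where P: "path6 E a b c d e f" using maximum_matching_and_path6 .
  obtain u where u: "u \<in> V" "u \<notin> \<Union>E" using isolated by blast
  have "{b, c} \<in> E" using P by (auto simp: path6_def adj_def)
  then have c: "c \<in> V" "c \<in> \<Union>E" using edge_sub by auto
  then have "has_P6_tP2 t (insert {u, c} E)"
    using saturating[of u c] u not_adj_isolated by blast
  from no_large_matching[OF P t_pos u(2) this M] show ?thesis .
qed

lemma uncovered_not_adj:
  assumes "matching E M" "card M = t + 2" "x \<notin> \<Union>M" "y \<notin> \<Union>M"
  shows "\<not> adj E x y"
proof
  assume "adj E x y"
  then have "matching E (insert {x, y} M) \<and> card (insert {x, y} M) = Suc (card M)"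
    using matching_card_insert assms by blast
  then show False using matching_card_le[of "insert {x, y} M"] assms(2) by simp
qed

text \<open>The copy created by the edge \<open>xy\<close> carries a matching \<open>K\<close> of
  size \<open>t + 3\<close>. This is too large for \<open>E\<close>, so \<open>K\<close> uses
  \<open>xy\<close>, and deleting that edge frees both of its ends.\<close>

lemma matching_avoiding_nonadjacent:
  assumes xy: "x \<in> V" "y \<in> V" "x \<noteq> y" "\<not> adj E x y"
  obtains N where "matching E N" "card N = t + 2" "x \<notin> \<Union>N" "y \<notin> \<Union>N"
proof -
  let ?E = "insert {x, y} E"
  interpret E': edge_set ?E
    using finite_E card_edge xy(3) by unfold_locales auto
  obtain a b c d e f F where P: "path6 ?E a b c d e f" and F: "matching ?E F"
    "\<Union>F \<inter> {a, b, c, d, e, f} = {}" "card F = t"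
    using saturating[OF xy] unfolding has_P6_tP2_def by blast
  define K where "K = insert {a, b} (insert {c, d} (insert {e, f} F))"
  have K: "matching ?E K" "card K = t + 3"
    using E'.path6_matching[OF P F(1,2)] F(3) by (auto simp: K_def)
  have xyK: "adj K x y"
  proof (rule ccontr)
    assume "\<not> adj K x y"
    then have "matching E K" using K(1) by (auto simp: matching_def adj_def)
    then show False using matching_card_le K(2) by fastforce
  qed
  note rem = E'.matching_card_remove[OF K(1) xyK]
  have "matching E (K - {{x, y}})" using rem(1) by (auto simp: matching_def)
  then show thesis using rem(2-4) K(2) by (intro that[of "K - {{x, y}}"]) auto
qed

section \<open>Transitivity of adjacency\<close>

lemma card_Union_matching:
  assumes "matching E M"
  shows "card (\<Union>M) = 2 * card M"
proof -
  have M: "M \<subseteq> E" "pairwise disjnt M" using assms by (auto simp: matching_def)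
  have "card (\<Union>M) = (\<Sum>e\<in>M. card e)"
    using M finite_edge by (intro card_Union_disjoint) auto
  also have "\<dots> = (\<Sum>e\<in>M. 2)" using M card_edge by (intro sum.cong) auto
  finally show ?thesis by simp
qed

lemma finite_Union_matching: "matching E M \<Longrightarrow> finite (\<Union>M)"
  using edge_sub finite_V by (meson Sup_least finite_subset matching_def subset_iff)

text \<open>Gallai's exchange argument. Nonadjacent \<open>x\<close> and \<open>z\<close> are missed
  by a maximum matching \<open>M\<close>, whereas a maximum matching \<open>N\<close> missing
  \<open>y\<close> has to cover its neighbours \<open>x\<close> and \<open>z\<close>. This forces a
  vertex \<open>v\<close> other than \<open>y\<close> that \<open>M\<close> covers and
  \<open>N\<close> misses, and exchanging an edge of \<open>N\<close> for the \<open>M\<close>-edge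
  at \<open>v\<close> brings \<open>N\<close> closer to \<open>M\<close>.\<close>

lemma adj_trans:
  assumes xy: "adj E x y" and yz: "adj E y z" and xz: "x \<noteq> z"
  shows "adj E x z"
proof (rule ccontr)
  assume nxz: "\<not> adj E x z"
  have V: "x \<in> V" "y \<in> V" "z \<in> V" using xy yz edge_sub by (auto simp: adj_def)
  obtain M where M: "matching E M" "card M = t + 2" "x \<notin> \<Union>M" "z \<notin> \<Union>M"
    using matching_avoiding_nonadjacent[OF V(1,3) xz nxz] .
  \<comment> \<open>Among the maximum matchings missing \<open>y\<close> take one closest to \<open>M\<close>; it can still be moved closer.\<close>
  define S where "S = {N. matching E N \<and> card N = t + 2 \<and> y \<notin> \<Union>N}"
  obtain u where u: "u \<in> V" "u \<notin> \<Union>E" using isolated by blast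
  have "y \<in> \<Union>E" using xy by (auto simp: adj_def)
  then have "u \<noteq> y" using u by blast
  then have "S \<noteq> {}"
    using not_adj_isolated[OF u(2)]
    by (rule matching_avoiding_nonadjacent[OF u(1) V(2)]) (auto simp: S_def)
  have "S \<subseteq> Pow E" by (auto simp: S_def matching_def)
  then have fin: "finite S" using finite_E by (meson finite_Pow_iff finite_subset)
  let ?f = "\<lambda>N. card (N \<inter> M)"
  have "Max (?f ` S) \<in> ?f ` S" using fin \<open>S \<noteq> {}\<close> by (intro Max_in) auto
  then obtain N where N: "N \<in> S" "Max (?f ` S) = ?f N" by blast
  have max: "card (N' \<inter> M) \<le> card (N \<inter> M)" if "N' \<in> S" for N'
    unfolding N(2)[symmetric] using fin that by (intro Max_ge) auto
  have mN: "matching E N" "card N = t + 2" "y \<notin> \<Union>N" using N(1) by (auto simp: S_def)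
  have xN: "x \<in> \<Union>N" "z \<in> \<Union>N"
    using uncovered_not_adj[OF mN, of x] uncovered_not_adj[OF mN, of z] adj_sym[OF xy] yz
    by metis+
  \<comment> \<open>\<open>M\<close> and \<open>N\<close> cover equally many vertices and
    \<open>N\<close> covers two that \<open>M\<close> misses, so \<open>M\<close> covers two that
    \<open>N\<close> misses; at most one of them is \<open>y\<close>.\<close>
  obtain v where v: "v \<in> \<Union>M" "v \<notin> \<Union>N" "v \<noteq> y"
  proof (rule ccontr)
    assume "\<not> thesis"
    then have "(\<Union>M - {y}) \<union> {x, z} \<subseteq> \<Union>N" using xN that by blast
    then have "card ((\<Union>M - {y}) \<union> {x, z}) \<le> card (\<Union>N)"
      using finite_Union_matching[OF mN(1)] by (rule card_mono[rotated])
    moreover have "card ((\<Union>M - {y}) \<union> {x, z}) = card (\<Union>M - {y}) + 2"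
      using M(3,4) xz finite_Union_matching[OF M(1)] by (subst card_Un_disjoint) auto
    moreover have "card (\<Union>M) - 1 \<le> card (\<Union>M - {y})"
      using diff_card_le_card_Diff[of "{y}" "\<Union>M"] by simp
    ultimately show False using card_Union_matching[OF mN(1)] card_Union_matching[OF M(1)] mN(2) M(2)
      by linarith
  qed
  obtain w where w: "adj M v w" using v(1) covered_iff[OF M(1), of v] by metis
  have vw: "adj E v w" using matching_adjD[OF M(1) w] .
  then have "w \<in> \<Union>N" using uncovered_not_adj[OF mN(1,2) v(2), of w] by metis
  then obtain w' where w': "adj N w w'" using covered_iff[OF mN(1), of w] by metis
  note rem = matching_card_remove[OF mN(1) w']
  let ?N = "insert {v, w} (N - {{w, w'}})"
  have N': "matching E ?N \<and> card ?N = Suc (card (N - {{w, w'}}))"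
    by (rule matching_card_insert) (use rem vw v in auto)
  have "w \<noteq> y" using \<open>w \<in> \<Union>N\<close> mN(3) by blast
  then have "?N \<in> S" using N' rem(2) mN v by (auto simp: S_def)
  \<comment> \<open>The edge removed from \<open>N\<close> is not in \<open>M\<close>, because the
    \<open>M\<close>-partner of \<open>w\<close> is \<open>v\<close>. Hence the exchange loses
    nothing of \<open>N \<inter> M\<close> and gains \<open>vw\<close>.\<close>
  have "w' \<noteq> v" using w' v(2) by (auto simp: adj_def)
  then have "\<not> adj M w w'" using matching_unique[OF M(1) adj_sym[OF w]] by blast
  then have "insert {v, w} (N \<inter> M) \<subseteq> ?N \<inter> M" using w by (auto simp: adj_def)
  moreover have "finite (?N \<inter> M)" using matching_finite[OF M(1)] by simp
  ultimately have "card (insert {v, w} (N \<inter> M)) \<le> card (?N \<inter> M)" by (intro card_mono)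
  moreover have "{v, w} \<notin> N \<inter> M" using v(2) by auto
  ultimately have "card (N \<inter> M) < card (?N \<inter> M)"
    using matching_finite[OF M(1)] by simp
  then show False using max[OF \<open>?N \<in> S\<close>] by simp
qed

section \<open>Decomposition into cliques\<close>

definition clique_of :: "'a \<Rightarrow> 'a set" where
  "clique_of x = insert x {y. adj E x y}"

text \<open>Indexed by the non-isolated vertices only, so that isolated vertices do not count as
  cliques of size one.\<close>

definition cliques :: "'a set set" where
  "cliques = clique_of ` \<Union>E"

lemma clique_of_eq: "y \<in> clique_of x \<Longrightarrow> clique_of y = clique_of x"
proof -
  have *: "clique_of b \<subseteq> clique_of a" if "adj E a b" for a b
    using that adj_trans[of a b] by (auto simp: clique_of_def)
  assume "y \<in> clique_of x"
  then show ?thesis using *[of x y] *[of y x] adj_sym[of E x y] by (auto simp: clique_of_def)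
qed

lemma cliques_eq_clique_of: "C \<in> cliques \<Longrightarrow> x \<in> C \<Longrightarrow> C = clique_of x"
  using clique_of_eq by (auto simp: cliques_def)

lemma Union_cliques: "\<Union>cliques = \<Union>E"
  by (auto simp: cliques_def clique_of_def adj_def)

lemma cliques_adj: "C \<in> cliques \<Longrightarrow> x \<in> C \<Longrightarrow> y \<in> C \<Longrightarrow> x \<noteq> y \<Longrightarrow> adj E x y"
  using cliques_eq_clique_of[of C x] by (auto simp: clique_of_def)

lemma adj_same_clique: "C \<in> cliques \<Longrightarrow> x \<in> C \<Longrightarrow> adj E x y \<Longrightarrow> y \<in> C"
  using cliques_eq_clique_of[of C x] by (auto simp: clique_of_def)

lemma cliques_disjnt: "C \<in> cliques \<Longrightarrow> D \<in> cliques \<Longrightarrow> C \<noteq> D \<Longrightarrow> C \<inter> D = {}"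
  using cliques_eq_clique_of by blast

lemma finite_Union_E: "finite (\<Union>E)"
  using edge_sub finite_V by (meson Sup_least finite_subset)

lemma finite_cliques: "finite cliques"
  using finite_Union_E by (simp add: cliques_def)

lemma finite_clique: "C \<in> cliques \<Longrightarrow> finite C"
  using Union_cliques finite_Union_E by (metis Union_upper finite_subset)

lemma edge_subset_clique: "e \<in> E \<Longrightarrow> C \<in> cliques \<Longrightarrow> x \<in> e \<Longrightarrow> x \<in> C \<Longrightarrow> e \<subseteq> C"
proof -
  assume e: "e \<in> E" "C \<in> cliques" "x \<in> e" "x \<in> C"
  then obtain y where y: "e = {x, y}" using edge_other by blast
  then have "adj E x y" using e(1) by (simp add: adj_def)
  then show "e \<subseteq> C" using adj_same_clique[OF e(2,4)] y e(4) by auto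
qed

text \<open>Each edge lies in exactly one clique. This is applied to a maximum matching as well as
  to the whole edge set.\<close>

lemma card_by_cliques:
  assumes K: "K \<subseteq> E"
  shows "card K = (\<Sum>C\<in>cliques. card {e \<in> K. e \<subseteq> C})"
proof -
  have "K = (\<Union>C\<in>cliques. {e \<in> K. e \<subseteq> C})"
  proof
    show "K \<subseteq> (\<Union>C\<in>cliques. {e \<in> K. e \<subseteq> C})"
    proof
      fix e assume e: "e \<in> K"
      then have "e \<in> E" using K by blast
      then obtain x where x: "x \<in> e" using card_edge[of e] by fastforce
      then have "x \<in> \<Union>cliques" using \<open>e \<in> E\<close> Union_cliques by blast
      then obtain C where "C \<in> cliques" "x \<in> C" by blast
      then show "e \<in> (\<Union>C\<in>cliques. {e \<in> K. e \<subseteq> C})"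
        using edge_subset_clique[OF \<open>e \<in> E\<close> _ x] e by blast
    qed
  qed blast
  moreover have "card (\<Union>C\<in>cliques. {e \<in> K. e \<subseteq> C}) = (\<Sum>C\<in>cliques. card {e \<in> K. e \<subseteq> C})"
  proof (rule card_UN_disjoint)
    show "finite cliques" by (rule finite_cliques)
    show "\<forall>C\<in>cliques. finite {e \<in> K. e \<subseteq> C}" using finite_subset[OF K finite_E] by simp
    show "\<forall>C\<in>cliques. \<forall>D\<in>cliques. C \<noteq> D \<longrightarrow> {e \<in> K. e \<subseteq> C} \<inter> {e \<in> K. e \<subseteq> D} = {}"
    proof (intro ballI impI)
      fix C D assume CD: "C \<in> cliques" "D \<in> cliques" "C \<noteq> D"
      have "e \<noteq> {}" if "e \<in> K" for e using that K card_edge by fastforce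
      then show "{e \<in> K. e \<subseteq> C} \<inter> {e \<in> K. e \<subseteq> D} = {}"
        using cliques_disjnt[OF CD] by blast
    qed
  qed
  ultimately show ?thesis by simp
qed

section \<open>Maximum matchings and the sizes of the cliques\<close>

lemma matching_in_clique:
  assumes M: "matching E M" and C: "C \<in> cliques"
  shows "card (C \<inter> \<Union>M) = 2 * card {e \<in> M. e \<subseteq> C}"
proof -
  have "M \<subseteq> E" using M by (simp add: matching_def)
  then have "C \<inter> \<Union>M = \<Union>{e \<in> M. e \<subseteq> C}" using edge_subset_clique[OF _ C] by blast
  moreover have "matching E {e \<in> M. e \<subseteq> C}"
    using M by (auto simp: matching_def intro: pairwise_subset)
  ultimately show ?thesis using card_Union_matching by metis
qed

text \<open>Two uncovered vertices of a clique would be adjacent and would enlarge the maximum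
  matching.\<close>

lemma card_uncovered_le:
  assumes M: "matching E M" "card M = t + 2" and C: "C \<in> cliques"
  shows "card (C - \<Union>M) \<le> 1"
proof -
  have "x = y" if "x \<in> C - \<Union>M" "y \<in> C - \<Union>M" for x y
    using that uncovered_not_adj[OF M, of x y] cliques_adj[OF C, of x y] by blast
  then show ?thesis using card_le_Suc0_iff_eq[of "C - \<Union>M"] finite_clique[OF C] by simp
qed

text \<open>A vertex \<open>x\<close> of \<open>C\<close> is not adjacent to an isolated vertex, so
  some maximum matching misses \<open>x\<close>. It misses no other vertex of \<open>C\<close>, and
  the covered ones are paired within \<open>C\<close>.\<close>

lemma card_clique_odd:
  assumes C: "C \<in> cliques"
  shows "odd (card C)"
proof -
  obtain x where x: "x \<in> C" "x \<in> \<Union>E"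
    using C by (auto simp: cliques_def clique_of_def)
  obtain u where u: "u \<in> V" "u \<notin> \<Union>E" using isolated by blast
  have "x \<in> V" "u \<noteq> x" "\<not> adj E u x" using x u edge_sub not_adj_isolated by blast+
  then obtain N where N: "matching E N" "card N = t + 2" "x \<notin> \<Union>N"
    using matching_avoiding_nonadjacent[OF u(1), of x] by metis
  have "x \<in> C - \<Union>N" "finite (C - \<Union>N)" using x N finite_clique[OF C] by auto
  then have "card (C - \<Union>N) \<noteq> 0" by auto
  then have "card (C - \<Union>N) = 1" using card_uncovered_le[OF N(1,2) C] by linarith
  moreover have "card C = card (C \<inter> \<Union>N) + card (C - \<Union>N)"
    using finite_clique[OF C] by (metis card_Int_Diff)
  ultimately show ?thesis using matching_in_clique[OF N(1) C] by simp
qed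

text \<open>By parity every maximum matching, not just a suitable one, misses exactly one vertex of
  \<open>C\<close>. So it contributes the same number of edges to each clique.\<close>

lemma card_clique_matching:
  assumes M: "matching E M" "card M = t + 2" and C: "C \<in> cliques"
  shows "card C = 2 * card {e \<in> M. e \<subseteq> C} + 1"
proof -
  have 1: "card C = card (C \<inter> \<Union>M) + card (C - \<Union>M)"
    using finite_clique[OF C] by (metis card_Int_Diff)
  have "card (C - \<Union>M) \<noteq> 0" using 1 matching_in_clique[OF M(1) C] card_clique_odd[OF C]
    by (metis add.right_neutral dvd_triv_left)
  then show ?thesis using 1 matching_in_clique[OF M(1) C] card_uncovered_le[OF M C] by linarith
qed

lemma edges_in_clique:
  assumes C: "C \<in> cliques" and m: "card C = 2 * m + 1"
  shows "card {e \<in> E. e \<subseteq> C} = m * (2 * m + 1)"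
proof -
  have "{e \<in> E. e \<subseteq> C} = {e. e \<subseteq> C \<and> card e = 2}"
    using card_edge cliques_adj[OF C] by (auto simp: card_2_iff adj_def)
  then have "card {e \<in> E. e \<subseteq> C} = (2 * m + 1) choose 2"
    using n_subsets[OF finite_clique[OF C], of 2] m by simp
  then show ?thesis by (simp add: choose_two)
qed

text \<open>With \<open>card D = 2 * m D + 1\<close> and the \<open>m D\<close> summing to
  \<open>t + 2\<close>, the number of edges is \<open>3 * (t + 2)\<close> plus twice the sum of the
  \<open>m D * (m D - 1)\<close>. The clique containing a P6 uses up the whole allowance for that
  sum, which leaves triangles for the rest.\<close>

lemma clique_structure:
  assumes few: "card E \<le> 3 * t + 18"
  obtains C where "card E = 3 * t + 18" "C \<in> cliques" "card C = 7"
    "\<And>D. D \<in> cliques \<Longrightarrow> D \<noteq> C \<Longrightarrow> card D = 3" "card cliques = t"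
proof -
  obtain a b c d e f M where P: "path6 E a b c d e f" and M: "matching E M" "card M = t + 2"
    using maximum_matching_and_path6 .
  define m where "m D = card {e \<in> M. e \<subseteq> D}" for D
  have cm: "card D = 2 * m D + 1" if "D \<in> cliques" for D
    using card_clique_matching[OF M that] by (simp add: m_def)
  have sum_m: "(\<Sum>D\<in>cliques. m D) = t + 2"
    using card_by_cliques[of M] M by (simp add: matching_def m_def)
  have "card E = (\<Sum>D\<in>cliques. m D * (2 * m D + 1))"
    using card_by_cliques[of E] edges_in_clique[OF _ cm] by simp
  also have "\<dots> = (\<Sum>D\<in>cliques. 3 * m D + 2 * (m D * (m D - 1)))"
  proof (rule sum.cong)
    show "m D * (2 * m D + 1) = 3 * m D + 2 * (m D * (m D - 1))" for D
      by (cases "m D") (auto simp: algebra_simps)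
  qed simp
  also have "\<dots> = 3 * (t + 2) + 2 * (\<Sum>D\<in>cliques. m D * (m D - 1))"
    by (simp add: sum.distrib sum_m flip: sum_distrib_left)
  finally have cE: "card E = 3 * (t + 2) + 2 * (\<Sum>D\<in>cliques. m D * (m D - 1))" .
  have m1: "m D \<ge> 1" if D: "D \<in> cliques" for D
  proof -
    obtain x e where x: "x \<in> D" "x \<in> e" "e \<in> E"
      using D by (auto simp: cliques_def clique_of_def)
    then obtain y where "e = {x, y}" using edge_other by blast
    then have xy: "adj E x y" using x(3) by (simp add: adj_def)
    then have "{x, y} \<subseteq> D" using x(1) adj_same_clique[OF D] by blast
    then have "card {x, y} \<le> card D" using finite_clique[OF D] by (rule card_mono[rotated])
    then show ?thesis using adj_irrefl[OF xy] cm[OF D] by simp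
  qed
  define C where "C = clique_of a"
  have p: "distinct [a, b, c, d, e, f]" "adj E a b" "adj E b c" "adj E c d" "adj E d e" "adj E e f"
    using P by (auto simp: path6_def)
  have C: "C \<in> cliques" using p by (auto simp: C_def cliques_def adj_def)
  have "a \<in> C" by (simp add: C_def clique_of_def)
  then have "{a, b, c, d, e, f} \<subseteq> C" using p(2-6) adj_same_clique[OF C] by blast
  then have "card {a, b, c, d, e, f} \<le> card C" using finite_clique[OF C] by (rule card_mono[rotated])
  then have m3: "m C \<ge> 3" using p(1) cm[OF C] by simp
  have split: "(\<Sum>D\<in>cliques. g D) = g C + (\<Sum>D\<in>cliques - {C}. g D)" for g :: "'a set \<Rightarrow> nat"
    using finite_cliques C by (simp add: sum.remove)
  \<comment> \<open>The bound \<open>3 * t + 18\<close> exceeds \<open>3 * (t + 2)\<close> by 12,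
    and the sum is counted twice. The value \<open>m C = 3\<close> contributes exactly 6.\<close>
  have le6: "m C * (m C - 1) + (\<Sum>D\<in>cliques - {C}. m D * (m D - 1)) \<le> 6"
    using cE few split[of "\<lambda>D. m D * (m D - 1)"] by simp
  have "m C = 3"
  proof (rule ccontr)
    assume "m C \<noteq> 3"
    then have "4 * 3 \<le> m C * (m C - 1)" using m3 by (intro mult_le_mono) auto
    then show False using le6 by simp
  qed
  then have rest: "(\<Sum>D\<in>cliques - {C}. m D * (m D - 1)) = 0" using le6 by simp
  have mD: "m D = 1" if "D \<in> cliques" "D \<noteq> C" for D
  proof -
    have "\<forall>D\<in>cliques - {C}. m D * (m D - 1) = 0"
      using rest finite_cliques by simp
    moreover have "D \<in> cliques - {C}" using that by blast
    ultimately have "m D * (m D - 1) = 0" by (rule bspec)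
    then show ?thesis using m1[OF that(1)] by auto
  qed
  have "card E = 3 * t + 18"
    using cE split[of "\<lambda>D. m D * (m D - 1)"] rest \<open>m C = 3\<close> by simp
  moreover have "card cliques = t"
  proof -
    have "(\<Sum>D\<in>cliques - {C}. m D) = card (cliques - {C})" using mD by simp
    then have "card (cliques - {C}) + 3 = t + 2" using split[of m] sum_m \<open>m C = 3\<close> by simp
    moreover have "Suc (card (cliques - {C})) = card cliques"
      using card_Suc_Diff1[OF finite_cliques C] .
    ultimately show ?thesis by linarith
  qed
  ultimately show thesis using C cm mD \<open>m C = 3\<close> by (intro that[of C]) auto
qed

end

section \<open>Copies of \<open>P\<^sub>6 + tP\<^sub>2\<close>\<close>

text \<open>An isomorphism preserves non-edges as well. An injective map \<open>g\<close> preserving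
  edges still suffices, because the subgraph can be taken to be the image of \<open>H\<close>
  without any further edges of \<open>G\<close>.\<close>

lemma contains_copy_iff_embedding:
  assumes H: "simple_graph H"
  shows "contains_copy G H \<longleftrightarrow> (\<exists>g. inj_on g (verts H) \<and> g ` verts H \<subseteq> verts G \<and>
    (\<forall>x\<in>verts H. \<forall>y\<in>verts H. {x, y} \<in> edges H \<longrightarrow> {g x, g y} \<in> edges G))"
proof
  assume "contains_copy G H"
  then obtain S f where S: "subgraph S G" and f: "bij_betw f (verts S) (verts H)"
    and fe: "\<forall>u\<in>verts S. \<forall>v\<in>verts S. {u, v} \<in> edges S \<longleftrightarrow> {f u, f v} \<in> edges H"
    unfolding contains_copy_def isomorphic_def by blast
  define g where "g = inv_into (verts S) f"
  have g: "bij_betw g (verts H) (verts S)" unfolding g_def by (rule bij_betw_inv_into[OF f])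
  have "{g x, g y} \<in> edges G" if "x \<in> verts H" "y \<in> verts H" "{x, y} \<in> edges H" for x y
  proof -
    have "f (g x) = x" "f (g y) = y" "g x \<in> verts S" "g y \<in> verts S"
      using that bij_betw_inv_into_right[OF f] bij_betwE[OF g] by (auto simp: g_def)
    then have "{g x, g y} \<in> edges S" using fe that(3) by simp
    then show ?thesis using S by (auto simp: subgraph_def)
  qed
  moreover have "inj_on g (verts H)" "g ` verts H = verts S" "verts S \<subseteq> verts G"
    using g S by (simp_all add: bij_betw_def subgraph_def)
  ultimately show "\<exists>g. inj_on g (verts H) \<and> g ` verts H \<subseteq> verts G \<and>
    (\<forall>x\<in>verts H. \<forall>y\<in>verts H. {x, y} \<in> edges H \<longrightarrow> {g x, g y} \<in> edges G)"
    by (intro exI[of _ g]) auto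
next
  assume "\<exists>g. inj_on g (verts H) \<and> g ` verts H \<subseteq> verts G \<and>
    (\<forall>x\<in>verts H. \<forall>y\<in>verts H. {x, y} \<in> edges H \<longrightarrow> {g x, g y} \<in> edges G)"
  then obtain g where inj: "inj_on g (verts H)" and gV: "g ` verts H \<subseteq> verts G"
    and g: "\<forall>x\<in>verts H. \<forall>y\<in>verts H. {x, y} \<in> edges H \<longrightarrow> {g x, g y} \<in> edges G"
    by (elim exE conjE)
  note ge = g[rule_format]
  define S where "S = \<lparr>verts = g ` verts H, edges = (`) g ` edges H\<rparr>"
  have eH: "e \<subseteq> verts H" "card e = 2" if "e \<in> edges H" for e
    using H that by (auto simp: simple_graph_def)
  have "card (g ` e) = 2" if "e \<in> edges H" for e
    using card_image[OF inj_on_subset[OF inj eH(1)[OF that]]] eH(2)[OF that] by simp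
  then have "simple_graph S"
    using H eH(1) by (auto simp: simple_graph_def S_def)
  moreover have "edges S \<subseteq> edges G"
  proof
    fix e' assume "e' \<in> edges S"
    then obtain e where e: "e \<in> edges H" "e' = g ` e" by (auto simp: S_def)
    then obtain x y where xy: "e = {x, y}" using eH(2)[OF e(1)] by (auto simp: card_2_iff)
    have "x \<in> verts H" "y \<in> verts H" using eH(1)[OF e(1)] xy by auto
    then show "e' \<in> edges G" using ge[of x y] e xy by simp
  qed
  ultimately have "subgraph S G" using gV by (auto simp: subgraph_def S_def)
  moreover have "S \<cong>\<^sub>g H"
    unfolding isomorphic_def
  proof (intro exI conjI ballI)
    let ?f = "inv_into (verts H) g"
    have "bij_betw g (verts H) (verts S)" using inj by (simp add: bij_betw_def S_def)
    then show "bij_betw ?f (verts S) (verts H)" by (rule bij_betw_inv_into)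
    fix u v assume "u \<in> verts S" "v \<in> verts S"
    then obtain x y where xy: "x \<in> verts H" "y \<in> verts H" "u = g x" "v = g y" by (auto simp: S_def)
    have f: "?f u = x" "?f v = y" using xy inj by simp_all
    have "{u, v} = g ` {x, y}" using xy by simp
    then have "{u, v} \<in> edges S \<longleftrightarrow> (\<exists>e\<in>edges H. g ` {x, y} = g ` e)" by (auto simp: S_def)
    also have "\<dots> \<longleftrightarrow> {x, y} \<in> edges H"
      using inj_on_image_eq_iff[OF inj, of "{x, y}"] xy(1,2) eH(1) by (metis empty_subsetI insert_subset)
    finally show "{u, v} \<in> edges S \<longleftrightarrow> {?f u, ?f v} \<in> edges H" using f by simp
  qed
  ultimately show "contains_copy G H" by (auto simp: contains_copy_def)
qed

abbreviation (input) P6_tP2 :: "nat \<Rightarrow> (nat + nat \<times> nat) graph" where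
  "P6_tP2 t \<equiv> path_graph 6 \<uplus>\<^sub>g copies t (path_graph 2)"

lemma path_graph_2_edges: "edges (path_graph 2) = {{0, 1}}"
  by (auto simp: path_graph_def)

lemma P6_tP2_verts:
  "verts (P6_tP2 t) = Inl ` {..<6} \<union> Inr ` ({..<t} \<times> {..<2})"
  by (auto simp: disjoint_union_def path_graph_def copies_def)

lemma P6_tP2_edges:
  "edges (P6_tP2 t) = (\<lambda>i. {Inl i, Inl (Suc i)}) ` {..<5} \<union> (\<lambda>k. {Inr (k, 0), Inr (k, 1)}) ` {..<t}"
proof -
  have "edges (path_graph 6) = (\<lambda>i. {i, Suc i}) ` {..<5}"
    by (auto simp: path_graph_def)
  then have "edges (P6_tP2 t) =
      (`) Inl ` (\<lambda>i. {i, Suc i}) ` {..<5} \<union> (`) Inr ` (\<Union>k<t. {{(k, 0), (k, 1)}})"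
    by (simp add: disjoint_union_def copies_def path_graph_2_edges)
  also have "(\<Union>k<t. {{(k, 0::nat), (k, 1::nat)}}) = (\<lambda>k. {(k, 0), (k, 1)}) ` {..<t}" by auto
  finally show ?thesis by (simp only: image_image image_insert image_empty)
qed

lemma contains_copy_imp_has_P6_tP2:
  assumes "contains_copy G (P6_tP2 t)"
  shows "has_P6_tP2 t (edges G)"
proof -
  have "simple_graph (P6_tP2 t)"
    by (intro simple_graph_disjoint_union simple_graph_copies simple_graph_path)
  from contains_copy_iff_embedding[OF this, THEN iffD1, OF assms]
  obtain g where g: "inj_on g (verts (P6_tP2 t))" and
    ge: "\<forall>x\<in>verts (P6_tP2 t). \<forall>y\<in>verts (P6_tP2 t). {x, y} \<in> edges (P6_tP2 t) \<longrightarrow> {g x, g y} \<in> edges G"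
    by (elim exE conjE)
  define p where "p i = g (Inl i)" for i
  define q where "q k j = g (Inr (k, j))" for k j
  have inj_p: "p i = p j \<longleftrightarrow> i = j" if "i < 6" "j < 6" for i j
    using inj_on_eq_iff[OF g] that by (simp add: p_def P6_tP2_verts)
  have inj_q: "q k i = q l j \<longleftrightarrow> k = l \<and> i = j"
    if "k < t" "l < t" "i < 2" "j < 2" for k l i j
    using inj_on_eq_iff[OF g, of "Inr (k, i)" "Inr (l, j)"] that by (simp add: q_def P6_tP2_verts)
  have pq: "p i \<noteq> q k j" if "i < 6" "k < t" "j < 2" for i k j
    using inj_on_eq_iff[OF g, of "Inl i" "Inr (k, j)"] that by (simp add: p_def q_def P6_tP2_verts)
  have pe: "adj (edges G) (p i) (p (Suc i))" if "i < 5" for i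
  proof -
    have "Inl i \<in> verts (P6_tP2 t)" "Inl (Suc i) \<in> verts (P6_tP2 t)"
      "{Inl i, Inl (Suc i)} \<in> edges (P6_tP2 t)"
      using that by (auto simp: P6_tP2_verts P6_tP2_edges)
    then show ?thesis unfolding adj_def p_def by (intro ge[rule_format])
  qed
  have qe: "{q k 0, q k 1} \<in> edges G" if "k < t" for k
  proof -
    have "Inr (k, 0) \<in> verts (P6_tP2 t)" "Inr (k, 1) \<in> verts (P6_tP2 t)"
      "{Inr (k, 0), Inr (k, 1)} \<in> edges (P6_tP2 t)"
      using that by (auto simp: P6_tP2_verts P6_tP2_edges)
    then show ?thesis unfolding q_def by (intro ge[rule_format])
  qed
  define F where "F = (\<lambda>k. {q k 0, q k 1}) ` {..<t}"
  have P: "path6 (edges G) (p 0) (p 1) (p 2) (p 3) (p 4) (p 5)"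
    using pe[of 0] pe[of 1] pe[of 2] pe[of 3] pe[of 4]
    by (simp add: path6_def inj_p eval_nat_numeral)
  have "matching (edges G) F"
    using qe by (auto simp: matching_def F_def pairwise_def disjnt_def inj_q)
  moreover have "card F = t"
  proof -
    have "inj_on (\<lambda>k. {q k 0, q k 1}) {..<t}"
      by (rule inj_onI) (auto simp: doubleton_eq_iff inj_q)
    then show ?thesis by (simp add: F_def card_image)
  qed
  moreover have "\<Union>F \<inter> {p 0, p 1, p 2, p 3, p 4, p 5} = {}"
    by (auto simp: F_def pq pq[symmetric])
  ultimately show ?thesis using P unfolding has_P6_tP2_def by blast
qed

lemma has_P6_tP2_imp_contains_copy:
  assumes G: "simple_graph G" and H: "has_P6_tP2 t (edges G)"
  shows "contains_copy G (P6_tP2 t)"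
proof -
  have eG: "e \<subseteq> verts G" "card e = 2" if "e \<in> edges G" for e
    using G that by (auto simp: simple_graph_def)
  obtain a b c d e f F where P: "path6 (edges G) a b c d e f" and F: "matching (edges G) F"
    "card F = t" "\<Union>F \<inter> {a, b, c, d, e, f} = {}"
    using H unfolding has_P6_tP2_def by blast
  have FE: "F \<subseteq> edges G" using F(1) by (simp add: matching_def)
  have "finite (edges G)"
    using G eG(1) finite_subset[of "edges G" "Pow (verts G)"] by (auto simp: simple_graph_def)
  then have "finite F" using FE finite_subset by blast
  then obtain h where h: "bij_betw h {..<t} F"
    using F(2) ex_bij_betw_nat_finite[of F] by (auto simp: lessThan_atLeast0)
  have hF: "h k \<in> F" if "k < t" for k using bij_betwE[OF h] that by simp
  have "\<exists>x y. h k = {x, y} \<and> x \<noteq> y" if "k < t" for k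
    using eG(2)[of "h k"] hF[OF that] FE by (auto simp: card_2_iff)
  then obtain x y where xy: "\<And>k. k < t \<Longrightarrow> h k = {x k, y k} \<and> x k \<noteq> y k" by metis
  have disj: "{x k, y k} \<inter> {x l, y l} = {}" if "k < t" "l < t" "k \<noteq> l" for k l
  proof -
    have "h k \<noteq> h l" using h that by (auto simp: bij_betw_def inj_on_eq_iff)
    then have "h k \<inter> h l = {}"
      using F(1) hF[OF that(1)] hF[OF that(2)] unfolding matching_def pairwise_def disjnt_def by blast
    then show ?thesis using xy that by simp
  qed
  have out: "x k \<notin> {a, b, c, d, e, f}" "y k \<notin> {a, b, c, d, e, f}" if "k < t" for k
    using F(3) hF[OF that] xy[OF that] by auto
  define L where "L = [a, b, c, d, e, f]"
  have L: "distinct L" "length L = 6" "set L = {a, b, c, d, e, f}"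
    using P by (auto simp: L_def path6_def)
  \<comment> \<open>Path vertex \<open>i\<close> goes to the entry \<open>i\<close> of
    \<open>L\<close>, and the two ends of the copy \<open>k\<close> of P2 go to the two ends of the
    edge \<open>h k\<close> of \<open>F\<close>.\<close>
  define g where "g = case_sum (\<lambda>i. L ! i) (\<lambda>(k, j :: nat). if j = 0 then x k else y k)"
  have "inj_on g (verts (P6_tP2 t))"
  proof (rule inj_onI)
    fix u v assume uv: "u \<in> verts (P6_tP2 t)" "v \<in> verts (P6_tP2 t)" "g u = g v"
    have Lin: "L ! i \<noteq> x k" "L ! i \<noteq> y k" if "i < 6" "k < t" for i k
      using nth_mem[of i L] L that out[OF that(2)] by metis+
    have xyd: "x k \<noteq> x l" "x k \<noteq> y l" "y k \<noteq> y l" if "k < t" "l < t" "k \<noteq> l" for k l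
      using disj[OF that] by auto
    have xyn: "x k \<noteq> y l" if "k < t" "l < t" for k l using xyd[OF that] xy[OF that(1)] by blast
    show "u = v"
    proof (cases u)
      case (Inl i)
      show ?thesis
      proof (cases v)
        case (Inl j)
        then show ?thesis using \<open>u = Inl i\<close> uv L nth_eq_iff_index_eq[of L i j]
          by (auto simp: g_def P6_tP2_verts)
      next
        case (Inr r)
        then show ?thesis using \<open>u = Inl i\<close> uv Lin
          by (auto simp: g_def P6_tP2_verts split: if_splits)
      qed
    next
      case (Inr r)
      show ?thesis
      proof (cases v)
        case (Inl j)
        then show ?thesis using \<open>u = Inr r\<close> uv Lin Lin[symmetric]
          by (auto simp: g_def P6_tP2_verts split: if_splits)
      next
        case (Inr s)
        then show ?thesis using \<open>u = Inr r\<close> uv xyd xyn xyn[symmetric]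
          by (auto simp: g_def P6_tP2_verts split: if_splits) (metis less_2_cases_iff One_nat_def)+
      qed
    qed
  qed
  moreover have "g ` verts (P6_tP2 t) \<subseteq> verts G"
  proof -
    have "set L \<subseteq> verts G"
      using P eG(1) by (auto simp: L_def path6_def adj_def)
    then have "L ! i \<in> verts G" if "i < 6" for i using that L(2) nth_mem[of i L] by auto
    moreover have "x k \<in> verts G" "y k \<in> verts G" if "k < t" for k
      using eG(1)[of "h k"] hF[OF that] FE xy[OF that] by auto
    ultimately show ?thesis by (auto simp: g_def P6_tP2_verts)
  qed
  moreover have "{g u, g v} \<in> edges G" if "{u, v} \<in> edges (P6_tP2 t)" for u v
  proof -
    have path: "{L ! i, L ! Suc i} \<in> edges G" if "i < 5" for i
    proof -
      have "i \<in> {0, 1, 2, 3, 4}" using that by auto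
      then show ?thesis using P by (auto simp: L_def path6_def adj_def eval_nat_numeral)
    qed
    have "{x k, y k} \<in> edges G" if "k < t" for k using xy[OF that] hF[OF that] FE by auto
    then have "g ` e \<in> edges G" if "e \<in> edges (P6_tP2 t)" for e
      using that path by (auto simp: P6_tP2_edges g_def)
    from this[OF that] show ?thesis by simp
  qed
  moreover have "simple_graph (P6_tP2 t)"
    by (intro simple_graph_disjoint_union simple_graph_copies simple_graph_path)
  ultimately show ?thesis
    by (subst contains_copy_iff_embedding) (auto intro!: exI[of _ g])
qed

section \<open>The extremal graph\<close>

lemma image_Inl_eq_iff: "Inl ` e = {Inl a, Inl b} \<longleftrightarrow> e = {a, b}"
  using inj_image_eq_iff[of Inl e "{a, b}"] by simp

lemma image_Inr_eq_iff: "Inr ` e = {Inr a, Inr b} \<longleftrightarrow> e = {a, b}"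
  using inj_image_eq_iff[of Inr e "{a, b}"] by simp

text \<open>Turns edges given as images of sets into conditions on their ends, so that an
  isomorphism can be checked case by case.\<close>

lemma disjoint_union_edge_iff:
  "{Inl a, Inl b} \<in> edges (G \<uplus>\<^sub>g H) \<longleftrightarrow> {a, b} \<in> edges G"
  "{Inr c, Inr d} \<in> edges (G \<uplus>\<^sub>g H) \<longleftrightarrow> {c, d} \<in> edges H"
  "{Inl a, Inr d} \<notin> edges (G \<uplus>\<^sub>g H)"
  "{Inr c, Inl b} \<notin> edges (G \<uplus>\<^sub>g H)"
proof -
  have *: "{u, v} \<in> edges (G \<uplus>\<^sub>g H) \<longleftrightarrow>
      (\<exists>e\<in>edges G. Inl ` e = {u, v}) \<or> (\<exists>e\<in>edges H. Inr ` e = {u, v})" for u v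
    by (auto simp: disjoint_union_def image_iff eq_commute)
  have no: "Inl ` e \<noteq> {Inr c, v}" "Inl ` e \<noteq> {v, Inr c}" "Inr ` e' \<noteq> {Inl a, v}" "Inr ` e' \<noteq> {v, Inl a}"
    for e :: "'a set" and e' :: "'b set" and v :: "'a + 'b" and a c by blast+
  show "{Inl a, Inl b} \<in> edges (G \<uplus>\<^sub>g H) \<longleftrightarrow> {a, b} \<in> edges G"
    "{Inr c, Inr d} \<in> edges (G \<uplus>\<^sub>g H) \<longleftrightarrow> {c, d} \<in> edges H"
    "{Inl a, Inr d} \<notin> edges (G \<uplus>\<^sub>g H)"
    "{Inr c, Inl b} \<notin> edges (G \<uplus>\<^sub>g H)"
    unfolding * by (simp_all add: no image_Inl_eq_iff image_Inr_eq_iff)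
qed

lemma copies_edge_iff:
  "{(i, a), (j, b)} \<in> edges (copies t G) \<longleftrightarrow> i < t \<and> i = j \<and> {a, b} \<in> edges G"
proof -
  have "Pair k ` e = {(i, a), (j, b)} \<longleftrightarrow> i = k \<and> j = k \<and> e = {a, b}" for k e
  proof
    assume eq: "Pair k ` e = {(i, a), (j, b)}"
    then have ij: "i = k" "j = k" by blast+
    then have "Pair k ` e = Pair k ` {a, b}" using eq by simp
    moreover have "inj (Pair k :: 'a \<Rightarrow> nat \<times> 'a)" by (simp add: inj_on_def)
    ultimately show "i = k \<and> j = k \<and> e = {a, b}" using ij by (simp only: inj_image_eq_iff)
  qed auto
  moreover have "{(i, a), (j, b)} \<in> edges (copies t G) \<longleftrightarrow>
      (\<exists>k<t. \<exists>e\<in>edges G. Pair k ` e = {(i, a), (j, b)})"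
    by (auto simp: copies_def image_iff eq_commute)
  ultimately show ?thesis by auto
qed

lemma complete_graph_edge_iff: "{a, b} \<in> edges (complete_graph k) \<longleftrightarrow> a < k \<and> b < k \<and> a \<noteq> b"
  by (auto simp: complete_graph_def card_2_iff doubleton_eq_iff)

text \<open>\<open>isomorphic\<close> asks for a map out of \<open>G\<close>, but the map onto
  \<open>G\<close> from the explicit graph \<open>H\<close> is the easier one to define.\<close>

lemma isomorphicI_inverse:
  assumes g: "bij_betw g (verts H) (verts G)"
    and e: "\<And>x y. x \<in> verts H \<Longrightarrow> y \<in> verts H \<Longrightarrow> {x, y} \<in> edges H \<longleftrightarrow> {g x, g y} \<in> edges G"
  shows "G \<cong>\<^sub>g H"
  unfolding isomorphic_def
proof (intro exI conjI ballI)
  let ?f = "inv_into (verts H) g"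
  show f: "bij_betw ?f (verts G) (verts H)" using g by (rule bij_betw_inv_into)
  fix u v assume uv: "u \<in> verts G" "v \<in> verts G"
  then show "{u, v} \<in> edges G \<longleftrightarrow> {?f u, ?f v} \<in> edges H"
    using e[of "?f u" "?f v"] bij_betwE[OF f] bij_betw_inv_into_right[OF g] by simp
qed

context P6_tP2_saturated
begin

text \<open>Enumerations of \<open>C\<close>, of the other cliques, of each of their vertex sets and
  of the isolated vertices are glued to one map \<open>g\<close> from the explicit graph onto
  \<open>V\<close>.\<close>

lemma isomorphic_to_extremal:
  assumes G: "verts G = V" "edges G = E" and n: "card V = n" "n \<ge> 3 * t + 6"
    and C: "C \<in> cliques" "card C = 7"
    and D: "\<And>D. D \<in> cliques \<Longrightarrow> D \<noteq> C \<Longrightarrow> card D = 3" and ct: "card cliques = t"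
  shows "G \<cong>\<^sub>g complete_graph 7 \<uplus>\<^sub>g copies (t - 1) (complete_graph 3) \<uplus>\<^sub>g empty_graph (n - 3 * t - 4)"
    (is "G \<cong>\<^sub>g ?K")
proof -
  let ?R = "cliques - {C}"
  have cR: "card ?R = t - 1" using ct finite_cliques C(1) by simp
  then obtain h where h: "bij_betw h {..<t - 1} ?R"
    using ex_bij_betw_nat_finite[of ?R] finite_cliques by (auto simp: lessThan_atLeast0)
  obtain k7 where k7: "bij_betw k7 {..<7 :: nat} C"
    using ex_bij_betw_nat_finite[OF finite_clique[OF C(1)]] C(2) by (auto simp: lessThan_atLeast0)
  have "\<exists>k. bij_betw k {..<3 :: nat} D" if "D \<in> ?R" for D
    using ex_bij_betw_nat_finite[OF finite_clique[of D]] D[of D] that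
    by (simp add: lessThan_atLeast0)
  then obtain k3 where k3: "\<And>D. D \<in> ?R \<Longrightarrow> bij_betw (k3 D) {..<3 :: nat} D" by metis
  have EV: "\<Union>E \<subseteq> V" using edge_sub by blast
  have UE: "\<Union>E = C \<union> \<Union>?R" using Union_cliques C(1) by blast
  moreover have "card (C \<union> \<Union>?R) = card C + card (\<Union>?R)"
  proof (rule card_Un_disjoint)
    show "finite C" using finite_clique[OF C(1)] .
    show "finite (\<Union>?R)" using finite_cliques finite_clique by auto
    show "C \<inter> \<Union>?R = {}" using cliques_disjnt[OF C(1)] by blast
  qed
  moreover have "card (\<Union>?R) = (\<Sum>D\<in>?R. card D)"
    using cliques_disjnt finite_clique
    by (intro card_Union_disjoint) (auto simp: pairwise_def disjnt_def)
  moreover have "(\<Sum>D\<in>?R. card D) = 3 * (t - 1)" using D cR by simp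
  \<comment> \<open>One clique of size 7 and \<open>t - 1\<close> triangles cover
    \<open>7 + 3 * (t - 1)\<close> vertices.\<close>
  ultimately have cE: "card (\<Union>E) = 3 * t + 4" using C(2) t_pos by simp
  then have "card (V - \<Union>E) = n - 3 * t - 4"
    using n(1) EV finite_Union_E by (simp add: card_Diff_subset)
  then obtain k0 where k0: "bij_betw k0 {..<n - 3 * t - 4} (V - \<Union>E)"
    using ex_bij_betw_nat_finite[of "V - \<Union>E"] finite_V by (auto simp: lessThan_atLeast0)
  define g where "g = case_sum (case_sum k7 (\<lambda>(i, j). k3 (h i) j)) k0"
  have vK: "verts ?K = Inl ` Inl ` {..<7} \<union> Inl ` Inr ` ({..<t - 1} \<times> {..<3}) \<union> Inr ` {..<n - 3 * t - 4}"
    by (auto simp: disjoint_union_def complete_graph_def copies_def empty_graph_def)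
  have hR: "h i \<in> ?R" if "i < t - 1" for i using bij_betwE[OF h] that by simp
  have k3m: "k3 (h i) j \<in> h i" if "i < t - 1" "j < 3" for i j
    using bij_betwE[OF k3[OF hR[OF that(1)]]] that(2) by simp
  have k7m: "k7 i \<in> C" if "i < 7" for i using bij_betwE[OF k7] that by simp
  have k0m: "k0 i \<in> V - \<Union>E" if "i < n - 3 * t - 4" for i using bij_betwE[OF k0] that by simp
  have gi: "g ` verts ?K = V"
  proof -
    have "(\<lambda>(i, j). k3 (h i) j) ` ({..<t - 1} \<times> {..<3}) = (\<Union>i<t - 1. k3 (h i) ` {..<3})" by auto
    also have "\<dots> = (\<Union>i<t - 1. h i)"
      using k3[OF hR] by (intro SUP_cong) (auto simp: bij_betw_def)
    also have "\<dots> = \<Union>?R" using h by (auto simp: bij_betw_def)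
    finally have "g ` verts ?K = C \<union> \<Union>?R \<union> (V - \<Union>E)"
      using k7 k0 unfolding vK image_Un image_image by (simp add: g_def bij_betw_def)
    also have "\<dots> = V" unfolding UE[symmetric] using EV by (rule Diff_partition)
    finally show ?thesis .
  qed
  have "card (verts ?K) = n"
  proof -
    have "card (verts ?K) = 7 + (t - 1) * 3 + (n - 3 * t - 4)"
      by (simp add: disjoint_union_def complete_graph_def copies_def empty_graph_def card_Plus)
    \<comment> \<open>\<open>t > 0\<close> and the lower bound on \<open>n\<close> keep both
      truncated differences exact.\<close>
    then show ?thesis using t_pos n(2) by simp
  qed
  moreover have "finite (verts ?K)" unfolding vK by simp
  \<comment> \<open>A surjection between finite sets of equal size is injective, which avoids
    comparing the pieces of \<open>g\<close> pairwise.\<close>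
  ultimately have "inj_on g (verts ?K)" using gi n(1) by (intro eq_card_imp_inj_on) simp_all
  then have bij: "bij_betw g (verts ?K) (verts G)" unfolding bij_betw_def using gi G(1) by simp
  have adj_iff: "adj E x y \<longleftrightarrow> x \<noteq> y" if "B \<in> cliques" "x \<in> B" "y \<in> B" for B x y
    using cliques_adj[OF that] adj_irrefl[of x y] by auto
  have nadj: "\<not> adj E x y" "\<not> adj E y x"
    if "A \<in> cliques" "B \<in> cliques" "A \<noteq> B" "x \<in> A" "y \<in> B" for A B x y
  proof -
    have "y \<notin> A" using cliques_disjnt[OF that(1-3)] that(5) by auto
    then show "\<not> adj E x y" "\<not> adj E y x"
      using adj_same_clique[OF that(1,4), of y] adj_sym[of E y x] by auto
  qed
  have iso: "\<not> adj E (k0 i) x" "\<not> adj E x (k0 i)" if "i < n - 3 * t - 4" for i x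
    using k0m[OF that] by (auto simp: adj_def)
  have hinj: "h i = h j \<longleftrightarrow> i = j" if "i < t - 1" "j < t - 1" for i j
    using h that by (auto simp: bij_betw_def inj_on_eq_iff)
  have k3inj: "k3 (h l) i = k3 (h l) j \<longleftrightarrow> i = j" if "l < t - 1" "i < 3" "j < 3" for i j l
    using k3[OF hR[OF that(1)]] that by (auto simp: bij_betw_def inj_on_eq_iff)
  have k7inj: "k7 i = k7 j \<longleftrightarrow> i = j" if "i < 7" "j < 7" for i j
    using k7 that by (auto simp: bij_betw_def inj_on_eq_iff)
  show ?thesis
  proof (rule isomorphicI_inverse[OF bij])
    fix x y assume xy: "x \<in> verts ?K" "y \<in> verts ?K"
    have c77: "adj E (k7 i) (k7 j) \<longleftrightarrow> i \<noteq> j" if "i < 7" "j < 7" for i j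
      using adj_iff[OF C(1) k7m k7m] k7inj that by simp
    have c73: "\<not> adj E (k7 i) (k3 (h l) j)" "\<not> adj E (k3 (h l) j) (k7 i)"
      if "i < 7" "l < t - 1" "j < 3" for i j l
      using nadj[OF C(1), of "h l"] hR[OF that(2)] k7m[OF that(1)] k3m[OF that(2,3)] by auto
    have c33: "adj E (k3 (h l) i) (k3 (h m) j) \<longleftrightarrow> l = m \<and> i \<noteq> j"
      if "l < t - 1" "m < t - 1" "i < 3" "j < 3" for i j l m
    proof (cases "l = m")
      case True
      then show ?thesis
          using adj_iff[of "h l"] hR[OF that(1)] k3m[OF that(1,3)] k3m[OF that(1,4)] k3inj[OF that(1,3,4)] by simp
    next
      case False
      then have "h l \<noteq> h m" using hinj that by simp
      then show ?thesis
          using False nadj(1)[of "h l" "h m"] hR[OF that(1)] hR[OF that(2)] k3m[OF that(1,3)] k3m[OF that(2,4)] by auto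
    qed
    have "{x, y} \<in> edges ?K \<longleftrightarrow> adj E (g x) (g y)"
      using xy unfolding vK
      by (auto simp: g_def disjoint_union_edge_iff copies_edge_iff complete_graph_edge_iff
          empty_graph_def c77 c73 c33 iso)
    then show "{x, y} \<in> edges ?K \<longleftrightarrow> {g x, g y} \<in> edges G"
      using G(2) by (simp add: adj_def)
  qed
qed

end

theorem theorem2p7:
  fixes n t :: nat and G :: "'a graph"
  assumes "n > 0" and "t > 0" and "n \<ge> 3 * t + 6"
    and "simple_graph G" and "card (verts G) = n"
    and "saturated (path_graph 6 \<uplus>\<^sub>g copies t (path_graph 2)) G"
    and "card (isolated_verts G) \<ge> 2"
    and "card (edges G) \<le> 3 * t + 18"
  shows "card (edges G) = 3 * t + 18 \<and>
    G \<cong>\<^sub>g complete_graph 7 \<uplus>\<^sub>g copies (t - 1) (complete_graph 3) \<uplus>\<^sub>g empty_graph (n - 3 * t - 4)"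
proof -
  have V: "finite (verts G)" and E: "\<And>e. e \<in> edges G \<Longrightarrow> e \<subseteq> verts G" "\<And>e. e \<in> edges G \<Longrightarrow> card e = 2"
    using assms(4) by (auto simp: simple_graph_def)
  have "finite (edges G)" using V E(1) finite_subset[of "edges G" "Pow (verts G)"] by auto
  moreover have "\<not> has_P6_tP2 t (edges G)"
    using assms(6) has_P6_tP2_imp_contains_copy[OF assms(4)] by (auto simp: saturated_def)
  moreover have "has_P6_tP2 t (insert {x, y} (edges G))"
    if "x \<in> verts G" "y \<in> verts G" "x \<noteq> y" "\<not> adj (edges G) x y" for x y
  proof -
    have "{x, y} \<in> edges (complement G)" using that by (simp add: complement_def adj_def)
    then have "contains_copy (add_edge G {x, y}) (P6_tP2 t)" using assms(6) by (simp add: saturated_def)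
    from contains_copy_imp_has_P6_tP2[OF this] show ?thesis by (simp add: add_edge_def)
  qed
  moreover have "\<exists>u v. u \<in> verts G \<and> v \<in> verts G \<and> u \<noteq> v \<and> u \<notin> \<Union>(edges G) \<and> v \<notin> \<Union>(edges G)"
  proof -
    obtain B where "B \<subseteq> isolated_verts G" "card B = 2"
      using obtain_subset_with_card_n[OF assms(7)] by blast
    then obtain u v where "u \<in> isolated_verts G" "v \<in> isolated_verts G" "u \<noteq> v" by (auto simp: card_2_iff)
    then show ?thesis by (auto simp: isolated_verts_def)
  qed
  ultimately interpret P6_tP2_saturated "edges G" t "verts G"
    using V E assms(2) by unfold_locales
  obtain C where C: "card (edges G) = 3 * t + 18" "C \<in> cliques" "card C = 7"
    "\<And>D. D \<in> cliques \<Longrightarrow> D \<noteq> C \<Longrightarrow> card D = 3" "card cliques = t"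
    using clique_structure[OF assms(8)] by blast
  show ?thesis
    using C(1) isomorphic_to_extremal[OF refl refl assms(5,3) C(2-5)] by blast
qed

end
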